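(* Let $n>2k>0$ and let $\mathcal F\subset\binom{[n]}{k}$ be an intersecting family. If $\gamma(\mathcal F)\ge\binom{n-u-1}{n-k-1}$ for some real $3\le u\le k$, then $$|\mathcal F|\le\binom{n-1}{k-1}+\binom{n-u-1}{n-k-1}-\binom{n-u-1}{k-1}.$$
   Context: $[n]=\{1,\dots,n\}$, $\binom{[n]}{k}$ denotes the family of all $k$-element subsets of $[n]$. A family is intersecting if any two of its sets intersect. For a family $\mathcal F$, $\Delta(\mathcal F):=\max_{i\in[n]}|\{F: i\in F\in\mathcal F\}|$ and the diversity is $\gamma(\mathcal F):=|\mathcal F|-\Delta(\mathcal F)$. For real $x$ and integer $m\ge0$, $\binom{x}{m}=x(x-1)\cdots(x-m+1)/m!$. *)

theory Defs
  imports Complex_Main "HOL-Library.Ramsey"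
begin

definition intersecting :: "'a set set \<Rightarrow> bool" where
  "intersecting F \<longleftrightarrow> (\<forall>A\<in>F. \<forall>B\<in>F. A \<inter> B \<noteq> {})"

definition max_degree :: "nat \<Rightarrow> nat set set \<Rightarrow> nat" where
  "max_degree n F = Max ((\<lambda>i. card {A \<in> F. i \<in> A}) ` {1..n})"

(* For finite F and n > 0 we have max_degree n F \<le> card F, so the subtraction on nat
   does not truncate. *)
definition diversity :: "nat \<Rightarrow> nat set set \<Rightarrow> nat" where
  "diversity n F = card F - max_degree n F"

end

theory Submission
  imports Defs
begin

text \<open>
  Write \<open>a = n - k - 1\<close>, \<open>b = k - 1\<close>, let \<open>\<gamma>\<^sub>i\<close> be the number of members avoiding \<open>i\<close>, and put
  \<open>f x = (x gchoose a) - (x gchoose b)\<close>. The members avoiding \<open>i\<close> cross-intersect those containing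
  \<open>i\<close>, so if \<open>\<gamma>\<^sub>i = (x gchoose a)\<close>, then the Lovasz form of the Kruskal--Katona theorem gives
  \<open>card F \<le> (n - 1 choose b) + f x\<close>. The function \<open>f\<close> first decreases and then increases, and
  \<open>f (n - 4) = f (n - 3)\<close>; this settles the case \<open>\<gamma>\<^sub>i \<le> (n - 3 choose a)\<close>.

  It remains to show that \<open>card F \<le> M\<close>, where \<open>M = (n - 1 choose b) + f (n - 4)\<close>, as soon as all
  \<open>\<gamma>\<^sub>i\<close> exceed \<open>(n - 3 choose a)\<close>. Shift a counterexample to the left as long as it stays one. A
  fully shifted counterexample is excluded by induction on \<open>n\<close>, since \<open>M\<close> satisfies Pascal's
  recurrence. Otherwise the process stops because each remaining shift \<open>(i, j)\<close> makes \<open>\<gamma>\<^sub>i\<close> jump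
  below \<open>(n - 4 choose a)\<close>. Two disjoint pairs cannot both do this, so the family is shifted outside
  \<open>{i, j}\<close>; but then the links of \<open>i\<close> and of \<open>j\<close> are positively correlated, so their intersection
  is too large for \<open>\<gamma>\<^sub>i\<close> to jump that far.
\<close>

section \<open>Links, deletions and shifts\<close>

definition link :: "'a \<Rightarrow> 'a set set \<Rightarrow> 'a set set" where
  "link v F = {G. v \<notin> G \<and> insert v G \<in> F}"

definition deletion :: "'a \<Rightarrow> 'a set set \<Rightarrow> 'a set set" where
  "deletion v F = {G \<in> F. v \<notin> G}"

definition cross :: "'a set set \<Rightarrow> 'a set set \<Rightarrow> bool" where
  "cross A B \<longleftrightarrow> (\<forall>X\<in>A. \<forall>Y\<in>B. X \<inter> Y \<noteq> {})"

definition shadow :: "'a set set \<Rightarrow> 'a set set" where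
  "shadow A = {X. \<exists>y. y \<notin> X \<and> insert y X \<in> A}"

text \<open>The shift replacing \<open>j\<close> by \<open>i\<close>, given by membership instead of as an image.\<close>

definition shift :: "'a \<Rightarrow> 'a \<Rightarrow> 'a set set \<Rightarrow> 'a set set" where
  "shift i j F = {X.
     if i \<in> X \<and> j \<notin> X then X \<in> F \<or> insert j (X - {i}) \<in> F
     else if j \<in> X \<and> i \<notin> X then X \<in> F \<and> insert i (X - {j}) \<in> F
     else X \<in> F}"

lemma card_link_deletion:
  assumes "finite F"
  shows "card F = card (link v F) + card (deletion v F)"
proof -
  have "inj_on (insert v) (link v F)"
    by (auto simp: link_def inj_on_def)
  then have "card (insert v ` link v F) = card (link v F)"
    by (rule card_image)
  moreover have "F = insert v ` link v F \<union> deletion v F"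
  proof (intro set_eqI iffI)
    fix X assume "X \<in> F"
    then show "X \<in> insert v ` link v F \<union> deletion v F"
      by (cases "v \<in> X")
        (auto simp: link_def deletion_def insert_absorb intro!: image_eqI[of _ _ "X - {v}"])
  qed (auto simp: link_def deletion_def)
  moreover have "insert v ` link v F \<inter> deletion v F = {}" by (auto simp: deletion_def)
  ultimately show ?thesis
    using assms by (metis card_Un_disjoint finite_Un)
qed

lemma finite_nsets_sub: "F \<subseteq> nsets X r \<Longrightarrow> finite X \<Longrightarrow> finite F"
  by (meson finite_imp_finite_nsets finite_subset)

lemma deletion_nsets: "F \<subseteq> nsets X r \<Longrightarrow> deletion v F \<subseteq> nsets (X - {v}) r"
  by (auto simp: deletion_def nsets_def)

lemma link_nsets: "F \<subseteq> nsets X (Suc r) \<Longrightarrow> link v F \<subseteq> nsets (X - {v}) r"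
  by (auto simp: link_def nsets_def)

lemma card_nsets_le:
  assumes "F \<subseteq> nsets X r" "finite X"
  shows "card F \<le> card X choose r"
  by (metis assms card_mono card_nsets finite_imp_finite_nsets)

lemma finite_link: "finite F \<Longrightarrow> finite (link v F)"
proof -
  have "link v F \<subseteq> (\<lambda>X. X - {v}) ` F"
    unfolding link_def by (intro subsetI image_eqI[of _ _ "insert v _"]) auto
  then show "finite F \<Longrightarrow> ?thesis" by (meson finite_imageI finite_subset)
qed

lemma finite_deletion: "finite F \<Longrightarrow> finite (deletion v F)"
  by (simp add: deletion_def)

section \<open>Effect of a shift on links and deletions\<close>

lemma link_link: "link i (link j F) = link j (link i F)"
  by (auto simp: link_def insert_commute)

lemma deletion_deletion: "deletion i (deletion j F) = deletion j (deletion i F)"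
  by (auto simp: deletion_def)

lemma link_deletion: "i \<noteq> j \<Longrightarrow> link i (deletion j F) = deletion j (link i F)"
  by (auto simp: deletion_def link_def)

text \<open>Of the four traces on \<open>{i, j}\<close>, a shift keeps the full and the empty one;
  the class at \<open>{i}\<close> becomes the union and the class at \<open>{j}\<close> the
  intersection of the two old classes. The counting lemmas on shifts are read off from this.\<close>

lemma shift_link_link: "i \<noteq> j \<Longrightarrow> link i (link j (shift i j F)) = link i (link j F)"
  by (auto simp: link_def shift_def)

lemma shift_deletion_deletion: "i \<noteq> j \<Longrightarrow> deletion i (deletion j (shift i j F)) = deletion i (deletion j F)"
  by (auto simp: deletion_def shift_def)

lemma shift_link_deletion: "i \<noteq> j \<Longrightarrow> link i (deletion j (shift i j F)) = link i (deletion j F) \<union> link j (deletion i F)"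
  by (auto simp: deletion_def link_def shift_def insert_Diff_if)

lemma shift_deletion_link: "i \<noteq> j \<Longrightarrow> link j (deletion i (shift i j F)) = link i (deletion j F) \<inter> link j (deletion i F)"
  by (auto simp: deletion_def link_def shift_def insert_Diff_if)

lemma shift_deletion_other:
  "l \<noteq> i \<Longrightarrow> l \<noteq> j \<Longrightarrow> deletion l (shift i j F) = shift i j (deletion l F)"
  by (auto simp: deletion_def shift_def)

lemma shift_nsets:
  assumes "F \<subseteq> nsets X r" "i \<in> X" "j \<in> X" "i \<noteq> j"
  shows "shift i j F \<subseteq> nsets X r"
proof
  fix Y assume Y: "Y \<in> shift i j F"
  show "Y \<in> nsets X r"
  proof (cases "Y \<in> F")
    case True then show ?thesis using assms by auto
  next
    case False
    then have *: "i \<in> Y" "j \<notin> Y" "insert j (Y - {i}) \<in> F"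
      using Y by (auto simp: shift_def split: if_splits)
    then have "insert j (Y - {i}) \<in> nsets X r" using assms by auto
    then have "Y \<subseteq> X" "finite Y" "card (insert j (Y - {i})) = r"
      using * assms(2) by (auto simp: nsets_def)
    then show ?thesis using * by (auto simp: nsets_def card.insert_remove card_Suc_Diff1 simp del: card_Diff_insert card_Diff_singleton)
  qed
qed

lemma card_four:
  assumes "finite F" "i \<noteq> j"
  shows "card F = card (link i (link j F)) + card (link i (deletion j F)) +
    card (link j (deletion i F)) + card (deletion i (deletion j F))"
  using card_link_deletion[of F j] card_link_deletion[of "link j F" i] card_link_deletion[of "deletion j F" i]
    assms link_deletion[of j i F] by (simp add: finite_link finite_deletion)

lemma card_deletion_split:
  assumes "finite F" "i \<noteq> j"
  shows "card (deletion i F) = card (link j (deletion i F)) + card (deletion i (deletion j F))"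
  using card_link_deletion[of "deletion i F" j] assms by (simp add: finite_deletion deletion_deletion)

lemma finite_shift:
  assumes "finite F" shows "finite (shift i j F)"
proof -
  have "shift i j F \<subseteq> F \<union> (\<lambda>X. insert i (X - {j})) ` F"
  proof
    fix X assume X: "X \<in> shift i j F"
    show "X \<in> F \<union> (\<lambda>X. insert i (X - {j})) ` F"
    proof (cases "X \<in> F")
      case False
      then have *: "i \<in> X" "j \<notin> X" "insert j (X - {i}) \<in> F"
        using X by (auto simp: shift_def split: if_splits)
      then have "X = insert i (insert j (X - {i}) - {j})" by auto
      then show ?thesis using * by blast
    qed auto
  qed
  then show ?thesis using assms by (meson finite_UnI finite_imageI finite_subset)
qed

lemma card_shift:
  assumes "finite F" "i \<noteq> j"
  shows "card (shift i j F) = card F"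
  using card_four[OF finite_shift[OF assms(1)] assms(2), of i j] card_four[OF assms]
    card_Un_Int[of "link i (deletion j F)" "link j (deletion i F)"] assms
  by (simp add: shift_link_link shift_deletion_deletion shift_link_deletion shift_deletion_link finite_link finite_deletion)

lemma card_deletion_shift:
  assumes "finite F" "i \<noteq> j"
  shows "card (deletion i (shift i j F)) = card (deletion i (deletion j F)) + card (link i (deletion j F) \<inter> link j (deletion i F))"
  using card_deletion_split[OF finite_shift[OF assms(1)] assms(2), of i j] assms
  by (simp add: shift_deletion_deletion shift_deletion_link)

lemma card_deletion_shift_sum:
  assumes "finite F" "i \<noteq> j"
  shows "card (deletion i (shift i j F)) + card (deletion j (shift i j F)) = card (deletion i F) + card (deletion j F)"
  using card_deletion_split[OF finite_shift[OF assms(1)] assms(2), of i j]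
    card_deletion_split[OF finite_shift[OF assms(1)], of j i i j]
    card_deletion_split[OF assms(1), of i j]
    card_deletion_split[OF assms(1), of j i]
    card_Un_Int[of "link i (deletion j F)" "link j (deletion i F)"] assms deletion_deletion[of i j]
    shift_deletion_deletion[of i j F]
  by (simp add: shift_deletion_link shift_link_deletion finite_link finite_deletion)

lemma card_deletion_shift_other:
  assumes "finite F" "i \<noteq> j" "l \<noteq> i" "l \<noteq> j"
  shows "card (deletion l (shift i j F)) = card (deletion l F)"
  using assms by (simp add: shift_deletion_other card_shift finite_deletion)

lemma shift_fixed:
  assumes "link j (deletion i F) \<subseteq> link i (deletion j F)" "i \<noteq> j"
  shows "shift i j F = F"
proof -
  have 1: "insert i (X - {j}) \<in> F" if "X \<in> F" "j \<in> X" "i \<notin> X" for X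
  proof -
    have "X - {j} \<in> link j (deletion i F)" using that assms(2) by (auto simp: link_def deletion_def insert_absorb)
    then show ?thesis using assms by (auto simp: link_def deletion_def)
  qed
  have 2: "X \<in> F" if "insert j (X - {i}) \<in> F" "i \<in> X" "j \<notin> X" for X
  proof -
    have "X = insert i (insert j (X - {i}) - {j})" using that by auto
    then show ?thesis using 1[OF that(1)] that assms(2) by auto
  qed
  have "X \<in> shift i j F \<longleftrightarrow> X \<in> F" for X
    using 1[of X] 2[of X] unfolding shift_def by (simp, blast)
  then show ?thesis by blast
qed

text \<open>An effective shift means that the class at \<open>{j}\<close> is not contained in the
  class at \<open>{i}\<close>, so replacing it by the intersection loses something. This makes
  shifting terminate.\<close>

lemma card_deletion_shift_less:
  assumes "finite F" "i \<noteq> j" "shift i j F \<noteq> F"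
  shows "card (deletion i (shift i j F)) < card (deletion i F)"
proof -
  have "card (link i (deletion j F) \<inter> link j (deletion i F)) < card (link j (deletion i F))"
    by (rule psubset_card_mono) (use assms shift_fixed[of j i F] in \<open>auto simp: finite_link finite_deletion\<close>)
  then show ?thesis
    using card_deletion_shift[OF assms(1,2)] card_deletion_split[OF assms(1,2)] by simp
qed

lemma shift_fixedD:
  assumes "shift i j F = F" "X \<in> F" "j \<in> X" "i \<notin> X"
  shows "insert i (X - {j}) \<in> F"
proof -
  have "X \<in> shift i j F" using assms by simp
  then show ?thesis using assms(3,4) by (auto simp: shift_def)
qed

text \<open>Only pairs with a new member \<open>X\<close> matter. A set \<open>Y\<close> disjoint
  from \<open>X\<close> avoids \<open>i\<close>; the preimage of \<open>X\<close> is compared with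
  \<open>Y\<close>, or with the shift of \<open>Y\<close> if \<open>j \<in> Y\<close>.\<close>

lemma shift_intersecting:
  assumes "intersecting F" "i \<noteq> j"
  shows "intersecting (shift i j F)"
  unfolding intersecting_def
proof (intro ballI)
  have main: "X \<inter> Y \<noteq> {}" if "X \<notin> F" "X \<in> shift i j F" "Y \<in> shift i j F" for X Y
  proof
    assume e: "X \<inter> Y = {}"
    have X: "i \<in> X" "j \<notin> X" "insert j (X - {i}) \<in> F"
      using that(1,2) by (auto simp: shift_def split: if_splits)
    then have "i \<notin> Y" using e by auto
    then have Y: "Y \<in> F" "j \<in> Y \<Longrightarrow> insert i (Y - {j}) \<in> F"
      using that(3) by (auto simp: shift_def split: if_splits)
    show False
    proof (cases "j \<in> Y")
      case True
      then have "insert i (Y - {j}) \<inter> insert j (X - {i}) \<noteq> {}"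
        using Y X assms unfolding intersecting_def by blast
      then show False using e assms(2) by auto
    next
      case False
      then have "Y \<inter> insert j (X - {i}) \<noteq> {}"
        using Y X assms unfolding intersecting_def by blast
      then show False using e False by auto
    qed
  qed
  fix X Y assume "X \<in> shift i j F" "Y \<in> shift i j F"
  then show "X \<inter> Y \<noteq> {}"
    using main[of X Y] main[of Y X] assms(1) by (cases "X \<in> F"; cases "Y \<in> F")
      (auto simp: intersecting_def Int_commute)
qed

lemma shadow_shift: "i \<noteq> j \<Longrightarrow> shadow (shift i j A) \<subseteq> shift i j (shadow A)"
proof
  fix X assume ij: "i \<noteq> j" and "X \<in> shadow (shift i j A)"
  then obtain y where y: "y \<notin> X" "insert y X \<in> shift i j A" by (auto simp: shadow_def)
  have I: "insert y Z \<in> A \<Longrightarrow> y \<notin> Z \<Longrightarrow> Z \<in> shadow A" for y Z by (auto simp: shadow_def)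
  consider "y = i" | "y = j" | "y \<noteq> i" "y \<noteq> j" by auto
  then show "X \<in> shift i j (shadow A)"
  proof cases
    case 1
    show ?thesis
    proof (cases "j \<in> X")
      case True
      \<comment> \<open>The superset contains both \<open>i\<close> and \<open>j\<close>, so it was
        not moved; removing either one puts both \<open>X\<close> and its shift into the
        shadow.\<close>
      then have "insert i X \<in> A" using 1 y ij by (auto simp: shift_def)
      moreover have "insert j (insert i (X - {j})) = insert i X" using True by auto
      ultimately show ?thesis
        using I[of i X] I[of j "insert i (X - {j})"] True 1 y ij
        by (auto simp: shift_def)
    next
      case False
      then have "insert i X \<in> A \<or> insert j X \<in> A" using 1 y by (auto simp: shift_def split: if_splits)
      then show ?thesis using I[of i X] I[of j X] False 1 y by (auto simp: shift_def)
    qed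
  next
    case 2
    show ?thesis
    proof (cases "i \<in> X")
      case True
      then have "insert j X \<in> A" using 2 y ij by (auto simp: shift_def)
      then show ?thesis using I[of j X] True 2 y by (auto simp: shift_def)
    next
      case False
      then have "insert j X \<in> A" using 2 y ij by (auto simp: shift_def)
      then show ?thesis using I[of j X] False 2 y by (auto simp: shift_def)
    qed
  next
    case 3
    have "insert y (insert j (X - {i})) = insert j (insert y X - {i})"
      "insert y (insert i (X - {j})) = insert i (insert y X - {j})"
      using 3 by auto
    then show ?thesis
      using y 3 ij I[of y X] I[of y "insert j (X - {i})"] I[of y "insert i (X - {j})"]
      by (simp add: shift_def split: if_splits) blast+
  qed
qed

lemma card_shadow_shift:
  assumes "finite (shadow A)" "i \<noteq> j"
  shows "card (shadow (shift i j A)) \<le> card (shadow A)"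
  using card_mono[OF finite_shift[OF assms(1)] shadow_shift[OF assms(2)]] assms
  by (simp add: card_shift)

section \<open>Shadows and cross-intersecting families\<close>

lemma shadow_nsets: "A \<subseteq> nsets X (Suc m) \<Longrightarrow> shadow A \<subseteq> nsets X m"
  by (auto simp: shadow_def nsets_def)

lemma finite_shadow: "A \<subseteq> nsets X (Suc m) \<Longrightarrow> finite X \<Longrightarrow> finite (shadow A)"
  by (rule finite_nsets_sub[OF shadow_nsets])

lemma shadow_nonempty:
  assumes "A \<subseteq> nsets X (Suc m)" "A \<noteq> {}"
  shows "shadow A \<noteq> {}"
proof -
  obtain Y where Y: "Y \<in> A" using assms by auto
  then have "card Y = Suc m" using assms by (auto simp: nsets_def)
  then obtain y where "y \<in> Y" by fastforce
  then have "Y - {y} \<in> shadow A" using Y by (auto simp: shadow_def insert_absorb intro: exI[of _ y])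
  then show ?thesis by auto
qed

text \<open>The hypothesis makes all factors \<open>x - i\<close> with \<open>i < m\<close>
  nonnegative; the same condition gives monotonicity below.\<close>

lemma gbinomial_nonneg:
  fixes x :: real
  assumes "real m \<le> x + 1"
  shows "0 \<le> x gchoose m"
  unfolding gbinomial_prod_rev using assms by (intro divide_nonneg_pos prod_nonneg) auto

lemma gbinomial_mono:
  fixes x y :: real
  assumes "real m \<le> x + 1" "x \<le> y"
  shows "x gchoose m \<le> y gchoose m"
  unfolding gbinomial_prod_rev using assms by (intro divide_right_mono prod_mono) auto

lemma gbinomial_ge_1:
  fixes x :: real
  assumes "real m \<le> x"
  shows "1 \<le> x gchoose m"
  using gbinomial_mono[of m "real m" x] assms binomial_gbinomial[of m m, where ?'a = real] by simp

text \<open>Each effective shift towards \<open>v\<close> lowers the number of sets avoiding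
  \<open>v\<close>, keeps the size and does not enlarge the shadow, so the process ends.\<close>

lemma stable_under_shifts:
  assumes "A \<subseteq> nsets X (Suc m)" "finite X" "v \<in> X"
  obtains A' where "A' \<subseteq> nsets X (Suc m)" "card A' = card A"
    "card (shadow A') \<le> card (shadow A)" "\<And>j. j \<in> X \<Longrightarrow> j \<noteq> v \<Longrightarrow> shift v j A' = A'"
proof -
  have "\<exists>A'. A' \<subseteq> nsets X (Suc m) \<and> card A' = card A \<and>
    card (shadow A') \<le> card (shadow A) \<and> (\<forall>j. j \<in> X \<longrightarrow> j \<noteq> v \<longrightarrow> shift v j A' = A')"
    using assms(1)
  proof (induction "card (deletion v A)" arbitrary: A rule: less_induct)
    case less
    have f: "finite A" "finite (shadow A)"
      using finite_nsets_sub finite_shadow less.prems assms(2) by blast+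
    show ?case
    proof (cases "\<forall>j. j \<in> X \<longrightarrow> j \<noteq> v \<longrightarrow> shift v j A = A")
      case True then show ?thesis using less.prems by blast
    next
      case False
      then obtain j where j: "j \<in> X" "v \<noteq> j" "shift v j A \<noteq> A" by blast
      show ?thesis
        using less.hyps[OF card_deletion_shift_less[OF f(1) j(2,3)]
            shift_nsets[OF less.prems assms(3) j(1,2)]]
          card_shift[OF f(1) j(2)] card_shadow_shift[OF f(2) j(2)]
        by (metis order_trans)
    qed
  qed
  then show thesis using that by blast
qed

text \<open>Lovasz's form of the Kruskal--Katona theorem, by Frankl's induction on the ground set:
  after shifting everything towards \<open>v\<close>, the shadow of the sets avoiding \<open>v\<close> lies in the link of \<open>v\<close>.\<close>

lemma lovasz_shadow:
  fixes x :: real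
  assumes "finite X" "A \<subseteq> nsets X (Suc m)" "A \<noteq> {}" "real m \<le> x" "x gchoose Suc m \<le> card A"
  shows "x gchoose m \<le> card (shadow A)"
  using assms
proof (induction "card X" arbitrary: X A m x)
  case 0
  then have "nsets X (Suc m) = {}" by (auto simp: nsets_def)
  then show ?case using 0 by simp
next
  case (Suc N)
  show ?case
  proof (cases m)
    case 0
    have "finite (shadow A)" "shadow A \<noteq> {}"
      using Suc.prems finite_shadow shadow_nonempty by blast+
    then have "card (shadow A) \<noteq> 0" by simp
    then show ?thesis using 0 by simp
  next
    case m: (Suc m')
    \<comment> \<open>As \<open>A\<close> is nonempty, \<open>x\<close> may be raised to
      \<open>Suc m\<close>, where the coefficient is 1. Then \<open>z - 1\<close> is large enough
      for the induction hypothesis on both parts.\<close>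
    define z where "z = max x (real (Suc m))"
    have z: "real (Suc m) \<le> z" "x \<le> z" by (auto simp: z_def)
    have "finite A" using Suc.prems finite_nsets_sub by blast
    then have "1 \<le> card A" using Suc.prems by (simp add: Suc_leI card_gt_0_iff)
    then have zA: "z gchoose Suc m \<le> card A"
      using Suc.prems binomial_gbinomial[of "Suc m" "Suc m", where ?'a = real]
      by (auto simp: z_def max_def)
    obtain v where v: "v \<in> X" using Suc.hyps(2) by fastforce
    obtain A' where A': "A' \<subseteq> nsets X (Suc m)" "card A' = card A"
      "card (shadow A') \<le> card (shadow A)" "\<And>j. j \<in> X \<Longrightarrow> j \<noteq> v \<Longrightarrow> shift v j A' = A'"
      using stable_under_shifts[OF Suc.prems(2,1) v] by blast
    define L where "L = link v A'"
    define D where "D = deletion v A'"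
    have X: "card (X - {v}) = N" "finite (X - {v})" using Suc.hyps(2) Suc.prems(1) v by auto
    have L: "L \<subseteq> nsets (X - {v}) (Suc m')" using A'(1) m by (auto simp: L_def intro!: link_nsets)
    have D: "D \<subseteq> nsets (X - {v}) (Suc m)" using A'(1) by (simp add: D_def deletion_nsets)
    have fin: "finite A'" "finite (shadow A')" "finite L" "finite (shadow L)"
      using finite_nsets_sub[OF A'(1)] finite_shadow[OF A'(1)] finite_nsets_sub[OF L]
        finite_shadow[OF L] X Suc.prems(1) by auto
    have AL: "card A = card L + card D"
      using card_link_deletion[OF fin(1)] A'(2) by (simp add: L_def D_def)
    have "shadow D \<subseteq> L"
    proof
      fix Y assume "Y \<in> shadow D"
      then obtain y where y: "y \<notin> Y" "insert y Y \<in> A'" "v \<notin> insert y Y"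
        by (auto simp: shadow_def D_def deletion_def)
      then have "y \<in> X" "y \<noteq> v" using A'(1) by (auto simp: nsets_def)
      then have "insert v (insert y Y - {y}) \<in> A'"
        using shift_fixedD[OF A'(4)] y by blast
      then show "Y \<in> L" using y by (simp add: L_def link_def)
    qed
    then have DL: "card (shadow D) \<le> card L" using fin card_mono by blast
    \<comment> \<open>The shadow of \<open>A'\<close> splits at \<open>v\<close>: its sets without
      \<open>v\<close> include \<open>L\<close>, and its link at \<open>v\<close> includes
      \<open>shadow L\<close>.\<close>
    have "shadow L \<subseteq> link v (shadow A')"
      by (auto simp: L_def link_def shadow_def insert_commute)
    moreover have "L \<subseteq> deletion v (shadow A')"
      by (auto simp: L_def link_def deletion_def shadow_def)
    ultimately have AS: "card (shadow L) + card L \<le> card (shadow A')"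
      using card_link_deletion[OF fin(2), of v] fin(2)
      by (simp add: add_mono card_mono finite_deletion finite_link)
    have pas: "z gchoose Suc k = (z - 1 gchoose k) + (z - 1 gchoose Suc k)" for k
      using gbinomial_Suc_Suc[of "z - 1" k] by simp
    \<comment> \<open>If \<open>L\<close> were smaller, Pascal's rule would make \<open>D\<close>
      large and, by induction, also its shadow, which lies in \<open>L\<close>.\<close>
    have Lge: "(z - 1) gchoose m \<le> card L"
    proof (rule ccontr)
      assume neg: "\<not> ?thesis"
      then have lt: "(z - 1) gchoose Suc m < card D" using pas[of m] zA AL by linarith
      moreover have "0 \<le> (z - 1) gchoose Suc m" using z by (intro gbinomial_nonneg) auto
      ultimately have "D \<noteq> {}" by auto
      then have "(z - 1) gchoose m \<le> card (shadow D)"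
        using Suc.hyps(1)[of "X - {v}" D m "z - 1"] X D z lt by auto
      then show False using neg DL by linarith
    qed
    moreover have "1 \<le> (z - 1) gchoose m" using z by (intro gbinomial_ge_1) auto
    ultimately have "L \<noteq> {}" by auto
    then have "(z - 1) gchoose m' \<le> card (shadow L)"
      using Suc.hyps(1)[of "X - {v}" L m' "z - 1"] X L z Lge m by auto
    then have "z gchoose m \<le> card (shadow A)"
      using pas[of m'] m Lge AS A'(3) by simp
    moreover have "x gchoose m \<le> z gchoose m" using Suc.prems z by (intro gbinomial_mono) auto
    ultimately show ?thesis by linarith
  qed
qed

section \<open>Cross-intersecting families via iterated shadows of complements\<close>

lemma iterated_shadow_nsets:
  assumes "A \<subseteq> nsets X (m + t)"
  shows "(shadow ^^ t) A \<subseteq> nsets X m"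
  using assms
proof (induction t arbitrary: m)
  case (Suc t)
  then have "(shadow ^^ t) A \<subseteq> nsets X (Suc m)" by simp
  then show ?case by (simp add: shadow_nsets)
qed simp

lemma iterated_shadow_subset:
  assumes "Y \<in> (shadow ^^ t) A"
  shows "\<exists>Z\<in>A. Y \<subseteq> Z"
  using assms
proof (induction t arbitrary: Y)
  case (Suc t)
  then have "Y \<in> shadow ((shadow ^^ t) A)" by simp
  then obtain y where "insert y Y \<in> (shadow ^^ t) A" unfolding shadow_def by blast
  then show ?case using Suc.IH by blast
qed auto

lemma lovasz_iterated_shadow:
  fixes x :: real
  assumes "finite X" "A \<subseteq> nsets X (m + t)" "real (m + t) \<le> x" "x gchoose (m + t) \<le> card A"
  shows "x gchoose m \<le> card ((shadow ^^ t) A)"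
  using assms
proof (induction t arbitrary: m)
  case (Suc t)
  \<comment> \<open>A coefficient of at least 1 keeps every intermediate shadow nonempty.\<close>
  have "1 \<le> x gchoose Suc m" using Suc.prems by (intro gbinomial_ge_1) auto
  moreover have "x gchoose Suc m \<le> card ((shadow ^^ t) A)"
    using Suc.IH[of "Suc m"] Suc.prems by simp
  moreover from this calculation have "(shadow ^^ t) A \<noteq> {}" by auto
  moreover have "(shadow ^^ t) A \<subseteq> nsets X (Suc m)"
    using iterated_shadow_nsets[of A X "Suc m" t] Suc.prems by simp
  ultimately show ?case
    using lovasz_shadow[of X "(shadow ^^ t) A" m x] Suc.prems by simp
qed simp

text \<open>A set in the iterated shadow lies in some \<open>X - Z\<close> with
  \<open>Z \<in> B\<close>, so it misses \<open>Z\<close> and cannot belong to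
  \<open>A\<close>.\<close>

lemma cross_shadow_disjoint:
  assumes "A \<subseteq> nsets X s" "B \<subseteq> nsets X r" "cross A B"
  shows "A \<inter> (shadow ^^ t) ((\<lambda>Y. X - Y) ` B) = {}"
proof (intro equals0I)
  fix Y assume Y: "Y \<in> A \<inter> (shadow ^^ t) ((\<lambda>Y. X - Y) ` B)"
  then obtain Z where "Z \<in> B" "Y \<subseteq> X - Z" using iterated_shadow_subset by blast
  then show False using Y assms(3) by (auto simp: cross_def)
qed

lemma complement_nsets:
  assumes "finite X" "B \<subseteq> nsets X r"
  shows "(\<lambda>Y. X - Y) ` B \<subseteq> nsets X (card X - r)"
  using assms by (auto simp: nsets_def card_Diff_subset subset_eq)

lemma card_complement:
  assumes "B \<subseteq> nsets X r"
  shows "card ((\<lambda>Y. X - Y) ` B) = card B"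
proof (rule card_image, rule inj_onI)
  fix Y Z assume "Y \<in> B" "Z \<in> B" "X - Y = X - Z"
  then show "Y = Z" using assms double_diff[of _ X X] by (auto simp: nsets_def)
qed

text \<open>On level \<open>s\<close>, the iterated shadow of the complements of \<open>B\<close> is
  disjoint from \<open>A\<close> and, by Lovasz's bound, has at least \<open>x gchoose s\<close>
  sets.\<close>

lemma cross_bound:
  fixes x :: real
  assumes "finite X" "A \<subseteq> nsets X s" "B \<subseteq> nsets X r" "cross A B" "r + s \<le> card X"
    and "real (card X - r) \<le> x" "x gchoose (card X - r) \<le> card B"
  shows "card A + (x gchoose s) \<le> card X choose s"
proof -
  define t where "t = card X - r - s"
  have t: "card X - r = s + t" using assms(5) by (simp add: t_def)
  define C where "C = (\<lambda>Y. X - Y) ` B"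
  have C: "C \<subseteq> nsets X (s + t)" "card C = card B"
    using complement_nsets[OF assms(1,3)] card_complement[OF assms(3)] t by (auto simp: C_def)
  have W: "(shadow ^^ t) C \<subseteq> nsets X s" by (rule iterated_shadow_nsets[OF C(1)])
  have "x gchoose s \<le> card ((shadow ^^ t) C)"
    using lovasz_iterated_shadow[OF assms(1) C(1)] assms(6,7) C(2) t by simp
  moreover have "card A + card ((shadow ^^ t) C) = card (A \<union> (shadow ^^ t) C)"
    using cross_shadow_disjoint[OF assms(2,3,4)] finite_nsets_sub[OF assms(2,1)]
      finite_nsets_sub[OF W assms(1)] by (simp add: card_Un_disjoint C_def)
  moreover have "card (A \<union> (shadow ^^ t) C) \<le> card X choose s"
    using assms(1,2) W by (intro card_nsets_le) auto
  ultimately show ?thesis by linarith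
qed

section \<open>Double counting and the local LYM inequality\<close>

lemma up_count:
  assumes "finite X" "L \<subseteq> nsets X m" "D \<subseteq> nsets X (Suc m)"
    and "\<And>G x. G \<in> L \<Longrightarrow> x \<in> X - G \<Longrightarrow> insert x G \<in> D"
  shows "card L * (card X - m) \<le> card D * Suc m"
proof -
  have fL: "finite L" and fD: "finite D" using finite_nsets_sub assms by blast+
  have fY: "Y \<in> D \<Longrightarrow> finite Y" for Y using assms by (auto simp: nsets_def)
  \<comment> \<open>Pairs of a set in \<open>L\<close> and an outside element inject into pairs of a
    set in \<open>D\<close> and one of its elements.\<close>
  have "card (SIGMA G:L. X - G) = (\<Sum>G\<in>L. card (X - G))"
    using fL assms(1) by (intro card_SigmaI) auto
  also have "\<dots> = (\<Sum>G\<in>L. card X - m)"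
    using assms(2) by (intro sum.cong) (auto simp: nsets_def card_Diff_subset)
  finally have 1: "card (SIGMA G:L. X - G) = card L * (card X - m)" by simp
  have "card (SIGMA Y:D. Y) = (\<Sum>Y\<in>D. card Y)"
    using fD fY by (intro card_SigmaI) auto
  also have "\<dots> = (\<Sum>Y\<in>D. Suc m)"
    using assms(3) by (intro sum.cong) (auto simp: nsets_def)
  finally have 2: "card (SIGMA Y:D. Y) = card D * Suc m" by simp
  have "card (SIGMA G:L. X - G) \<le> card (SIGMA Y:D. Y)"
  proof (rule card_inj_on_le[of "\<lambda>(G, x). (insert x G, x)"])
    show "inj_on (\<lambda>(G, x). (insert x G, x)) (SIGMA G:L. X - G)"
      by (auto simp: inj_on_def insert_eq_iff)
    show "(\<lambda>(G, x). (insert x G, x)) ` (SIGMA G:L. X - G) \<subseteq> (SIGMA Y:D. Y)"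
      using assms(4) by auto
    show "finite (SIGMA Y:D. Y)" using fD fY by auto
  qed
  then show ?thesis using 1 2 by simp
qed

lemma shadow_count:
  assumes "finite X" "A \<subseteq> nsets X (Suc m)"
  shows "card A * Suc m \<le> card (shadow A) * (card X - m)"
proof -
  note S = shadow_nsets[OF assms(2)]
  have fA: "finite A" and fS: "finite (shadow A)" using finite_nsets_sub assms S by blast+
  have fY: "Y \<in> A \<Longrightarrow> finite Y" for Y using assms by (auto simp: nsets_def)
  have "card (SIGMA G:shadow A. X - G) = (\<Sum>G\<in>shadow A. card (X - G))"
    using fS assms(1) by (intro card_SigmaI) auto
  also have "\<dots> = (\<Sum>G\<in>shadow A. card X - m)"
    using S by (intro sum.cong) (auto simp: nsets_def card_Diff_subset)
  finally have 1: "card (SIGMA G:shadow A. X - G) = card (shadow A) * (card X - m)" by simp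
  have "card (SIGMA Y:A. Y) = (\<Sum>Y\<in>A. card Y)"
    using fA fY by (intro card_SigmaI) auto
  also have "\<dots> = (\<Sum>Y\<in>A. Suc m)"
    using assms(2) by (intro sum.cong) (auto simp: nsets_def)
  finally have 2: "card (SIGMA Y:A. Y) = card A * Suc m" by simp
  have "card (SIGMA Y:A. Y) \<le> card (SIGMA G:shadow A. X - G)"
  proof (rule card_inj_on_le[of "\<lambda>(Y, y). (Y - {y}, y)"])
    show "inj_on (\<lambda>(Y, y). (Y - {y}, y)) (SIGMA Y:A. Y)"
      by (auto simp: inj_on_def)
    have "Y - {y} \<in> shadow A" if "Y \<in> A" "y \<in> Y" for Y y
      using that by (auto simp: shadow_def insert_absorb intro!: exI[of _ y])
    then show "(\<lambda>(Y, y). (Y - {y}, y)) ` (SIGMA Y:A. Y) \<subseteq> (SIGMA G:shadow A. X - G)"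
      using assms(2) by (auto simp: nsets_def)
    show "finite (SIGMA G:shadow A. X - G)" using fS assms(1) by auto
  qed
  then show ?thesis using 1 2 by simp
qed

lemma binomial_step: "(N choose Suc m) * Suc m = (N choose m) * (N - m)"
  using binomial_absorb_comp[of N m] binomial_absorption[of m "N"] 
  by (metis Suc_times_binomial_eq binomial_absorb_comp mult.commute)

text \<open>The double count as a comparison of densities, cross-multiplied to stay within
  \<open>nat\<close>.\<close>

lemma local_lym:
  assumes "finite X" "A \<subseteq> nsets X (Suc m)"
  shows "card A * (card X choose m) \<le> card (shadow A) * (card X choose Suc m)"
proof (cases "m < card X")
  case True
  have "card A * (card X choose m) * (card X - m) = card A * Suc m * (card X choose Suc m)"
    using binomial_step[of "card X" m] by (metis mult.assoc mult.commute)
  also have "\<dots> \<le> card (shadow A) * (card X - m) * (card X choose Suc m)"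
    using shadow_count[OF assms] by (rule mult_right_mono) simp
  finally have "(card X - m) * (card A * (card X choose m)) \<le>
    (card X - m) * (card (shadow A) * (card X choose Suc m))" by (simp add: ac_simps)
  then show ?thesis using True by simp
next
  case False
  then have "card A \<le> 0" using card_nsets_le[OF assms(2,1)] by (simp add: binomial_eq_0)
  then show ?thesis by simp
qed

lemma iterated_local_lym:
  assumes "finite X" "A \<subseteq> nsets X (m + t)" "m + t \<le> card X"
  shows "card A * (card X choose m) \<le> card ((shadow ^^ t) A) * (card X choose (m + t))"
  using assms
proof (induction t arbitrary: m)
  case (Suc t)
  let ?S = "(shadow ^^ t) A"
  have 1: "card A * (card X choose Suc m) \<le> card ?S * (card X choose (m + Suc t))"
    using Suc.IH[of "Suc m"] Suc.prems by simp
  have "?S \<subseteq> nsets X (Suc m)" using iterated_shadow_nsets[of A X "Suc m" t] Suc.prems by simp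
  from local_lym[OF Suc.prems(1) this]
  have 2: "card ?S * (card X choose m) \<le> card (shadow ?S) * (card X choose Suc m)" .
  \<comment> \<open>The two density inequalities are multiplied; the common factor
    \<open>card X choose Suc m\<close> is positive and cancels.\<close>
  have "(card X choose Suc m) * (card A * (card X choose m)) \<le>
    card ?S * (card X choose (m + Suc t)) * (card X choose m)"
    using mult_right_mono[OF 1, of "card X choose m"] by (simp add: ac_simps)
  also have "\<dots> \<le> (card X choose Suc m) * (card (shadow ?S) * (card X choose (m + Suc t)))"
    using mult_right_mono[OF 2, of "card X choose (m + Suc t)"] by (simp add: ac_simps)
  finally show ?case using Suc.prems by simp
qed simp

text \<open>The complements of \<open>B\<close> live on level \<open>card X - r\<close>, which has
  as many sets as level \<open>r\<close>. The LYM inequality thus makes their shadow on level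
  \<open>r\<close> at least as large as \<open>B\<close>, and this shadow is disjoint from
  \<open>A\<close>.\<close>

lemma cross_sum_bound:
  assumes "finite X" "A \<subseteq> nsets X r" "B \<subseteq> nsets X r" "cross A B" "2 * r \<le> card X"
  shows "card A + card B \<le> card X choose r"
proof -
  define t where "t = card X - r - r"
  have t: "card X - r = r + t" using assms(5) by (simp add: t_def)
  define C where "C = (\<lambda>Y. X - Y) ` B"
  have C: "C \<subseteq> nsets X (r + t)" "card C = card B"
    using complement_nsets[OF assms(1,3)] card_complement[OF assms(3)] t by (auto simp: C_def)
  have W: "(shadow ^^ t) C \<subseteq> nsets X r" by (rule iterated_shadow_nsets[OF C(1)])
  have "card X choose (r + t) = card X choose r"
    using binomial_symmetric[of r "card X"] t assms(5) by simp
  moreover have "0 < card X choose r" using assms(5) by (simp add: zero_less_binomial)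
  ultimately have "card B \<le> card ((shadow ^^ t) C)"
    using iterated_local_lym[OF assms(1) C(1)] t C(2) by simp
  moreover have "card A + card ((shadow ^^ t) C) = card (A \<union> (shadow ^^ t) C)"
    using cross_shadow_disjoint[OF assms(2,3,4)] finite_nsets_sub[OF assms(2,1)]
      finite_nsets_sub[OF W assms(1)] by (simp add: card_Un_disjoint C_def)
  moreover have "card (A \<union> (shadow ^^ t) C) \<le> card X choose r"
    using assms(1,2) W by (intro card_nsets_le) auto
  ultimately show ?thesis by linarith
qed

section \<open>Correlation of shifted families\<close>

text \<open>\<open>X\<close> may be smaller than the ground set of \<open>F\<close>, so shiftedness
  away from two chosen points can be expressed.\<close>

definition shifted_on :: "'a::linorder set \<Rightarrow> 'a set set \<Rightarrow> bool" where
  "shifted_on X F \<longleftrightarrow>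
    (\<forall>a\<in>X. \<forall>b\<in>X. \<forall>Y\<in>F. a < b \<longrightarrow> b \<in> Y \<longrightarrow> a \<notin> Y \<longrightarrow> insert a (Y - {b}) \<in> F)"

lemma shifted_onD:
  "shifted_on X F \<Longrightarrow> Y \<in> F \<Longrightarrow> a \<in> X \<Longrightarrow> b \<in> X \<Longrightarrow> a < b \<Longrightarrow> b \<in> Y \<Longrightarrow> a \<notin> Y
    \<Longrightarrow> insert a (Y - {b}) \<in> F"
  by (auto simp: shifted_on_def)

lemma shifted_on_deletion:
  assumes "shifted_on X F"
  shows "shifted_on (X - {v}) (deletion v F)"
  using assms by (auto simp: shifted_on_def deletion_def)

lemma shifted_on_link:
  assumes "shifted_on X F"
  shows "shifted_on (X - {v}) (link v F)"
  unfolding shifted_on_def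
proof (intro ballI impI)
  fix a b Y assume *: "a \<in> X - {v}" "b \<in> X - {v}" "Y \<in> link v F" "a < b" "b \<in> Y" "a \<notin> Y"
  then have "insert a (insert v Y - {b}) \<in> F"
    by (intro shifted_onD[OF assms]) (auto simp: link_def)
  moreover have "insert a (insert v Y - {b}) = insert v (insert a (Y - {b}))"
    using * by auto
  ultimately show "insert a (Y - {b}) \<in> link v F" using * by (auto simp: link_def)
qed

text \<open>Chebyshev's sum inequality with weights \<open>c0\<close> and \<open>c1\<close>: both
  pairs of densities are ordered the same way, so the product of their differences is
  nonnegative.\<close>

lemma chebyshev_two:
  fixes a0 a1 b0 b1 i0 i1 c0 c1 :: real
  assumes "a1 * b1 \<le> i1 * c1" "a0 * b0 \<le> i0 * c0" "a1 * c0 \<le> a0 * c1" "b1 * c0 \<le> b0 * c1"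
    and "0 < c0" "0 < c1"
  shows "(a1 + a0) * (b1 + b0) \<le> (i1 + i0) * (c1 + c0)"
proof -
  have "0 \<le> (a0 * c1 - a1 * c0) * (b0 * c1 - b1 * c0)" using assms by simp
  then have "(a1 * b0 + a0 * b1) * (c0 * c1) \<le> a0 * b0 * c1 * c1 + a1 * b1 * c0 * c0"
    by (simp add: algebra_simps)
  also have "\<dots> \<le> i0 * c0 * c1 * c1 + i1 * c1 * c0 * c0"
    using assms by (intro add_mono mult_right_mono) auto
  also have "\<dots> = (i0 * c1 + i1 * c0) * (c0 * c1)" by (simp add: algebra_simps)
  finally have "a1 * b0 + a0 * b1 \<le> i0 * c1 + i1 * c0" using assms by simp
  then show ?thesis using assms(1,2) by (simp add: algebra_simps)
qed

text \<open>As \<open>v\<close> is the largest element, any missing \<open>x\<close> may replace it.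
  Every \<open>G\<close> in the link thus extends by each such \<open>x\<close> to a set in the
  deletion, and \<open>up_count\<close> compares the densities.\<close>

lemma shifted_density:
  assumes "finite X" "X \<noteq> {}" "A \<subseteq> nsets X (Suc m)" "shifted_on X A"
  defines "v \<equiv> Max X"
  shows "card (link v A) * (card (X - {v}) choose Suc m) \<le>
    card (deletion v A) * (card (X - {v}) choose m)"
proof -
  let ?N = "card (X - {v})"
  have v: "v \<in> X" "\<And>x. x \<in> X - {v} \<Longrightarrow> x < v"
    using assms(1,2) by (auto simp: v_def) (metis Max_ge le_neq_trans)
  have "card (link v A) * (?N - m) \<le> card (deletion v A) * Suc m"
  proof (rule up_count)
    fix G x assume G: "G \<in> link v A" "x \<in> X - {v} - G"
    then have "insert x (insert v G - {v}) \<in> A"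
      using v by (intro shifted_onD[OF assms(4)]) (auto simp: link_def)
    then show "insert x G \<in> deletion v A" using G by (auto simp: link_def deletion_def)
  qed (use assms(1,3) link_nsets deletion_nsets in \<open>simp_all add: v_def\<close>)
  then have "card (link v A) * (?N - m) * (?N choose m) \<le> card (deletion v A) * Suc m * (?N choose m)"
    by (rule mult_right_mono) simp
  then have "card (link v A) * ((?N choose m) * (?N - m)) \<le> Suc m * (card (deletion v A) * (?N choose m))"
    by (simp only: ac_simps)
  then have "Suc m * (card (link v A) * (?N choose Suc m)) \<le> Suc m * (card (deletion v A) * (?N choose m))"
    unfolding binomial_step[symmetric] by (simp only: ac_simps)
  then show ?thesis by (simp only: Suc_mult_le_cancel1)
qed

text \<open>The induction step, splitting off the largest element, is Chebyshev's sum inequality: the density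
  of the deletion is at least that of the link.\<close>

lemma shifted_correlation:
  assumes "finite X" "A \<subseteq> nsets X r" "B \<subseteq> nsets X r" "shifted_on X A" "shifted_on X B"
  shows "card A * card B \<le> card (A \<inter> B) * (card X choose r)"
  using assms
proof (induction "card X" arbitrary: X A B r)
  case 0
  then have "A \<subseteq> {{}}" "B \<subseteq> {{}}" by (auto simp: nsets_def)
  then consider "A = {}" | "B = {}" | "A = {{}}" "B = {{}}" by blast
  then show ?case using 0 by cases (auto simp: nsets_def)
next
  case (Suc N)
  show ?case
  proof (cases r)
    case 0
    then have "A \<subseteq> {{}}" "B \<subseteq> {{}}" using Suc.prems by (auto simp: nsets_def)
    then consider "A = {}" | "B = {}" | "A = {{}}" "B = {{}}" by blast
    then show ?thesis using 0 by cases auto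
  next
    case r: (Suc m)
    define v where "v = Max X"
    have ne: "X \<noteq> {}" using Suc.hyps(2) by auto
    have v: "v \<in> X" using Suc.prems ne by (simp add: v_def)
    have N: "card (X - {v}) = N" using Suc v by auto
    have fin: "finite A" "finite B" using Suc.prems finite_nsets_sub by blast+
    have lkI: "link v (A \<inter> B) = link v A \<inter> link v B" and dlI: "deletion v (A \<inter> B) = deletion v A \<inter> deletion v B"
      by (auto simp: link_def deletion_def)
    note split = card_link_deletion[of A v, OF fin(1)] card_link_deletion[of B v, OF fin(2)]
      card_link_deletion[of "A \<inter> B" v, unfolded lkI dlI]
    have 1: "card (link v A) * card (link v B) \<le> card (link v A \<inter> link v B) * (N choose m)"
      using Suc.hyps(1)[of "X - {v}" "link v A" m "link v B"] N Suc.prems r link_nsets shifted_on_link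
      by (metis finite_Diff)
    have 0: "card (deletion v A) * card (deletion v B) \<le> card (deletion v A \<inter> deletion v B) * (N choose Suc m)"
      using Suc.hyps(1)[of "X - {v}" "deletion v A" "Suc m" "deletion v B"] N Suc.prems r deletion_nsets shifted_on_deletion
      by (metis finite_Diff)
    have dA: "card (link v A) * (N choose Suc m) \<le> card (deletion v A) * (N choose m)"
      and dB: "card (link v B) * (N choose Suc m) \<le> card (deletion v B) * (N choose m)"
      using shifted_density[of X A m] shifted_density[of X B m] Suc.prems r N ne
      unfolding v_def by simp_all
    have "deletion v A \<subseteq> nsets (X - {v}) (Suc m)" "deletion v B \<subseteq> nsets (X - {v}) (Suc m)"
      "link v A \<subseteq> nsets (X - {v}) m"
      using deletion_nsets[of A X r] deletion_nsets[of B X r] link_nsets[of A X m] Suc.prems(2,3) r by simp_all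
    then have le: "card (deletion v A) \<le> N choose Suc m" "card (deletion v B) \<le> N choose Suc m"
      "card (link v A) \<le> N choose m"
      using card_nsets_le[of _ "X - {v}"] N Suc.prems(1) by force+
    have C: "card X choose r = (N choose m) + (N choose Suc m)"
      using r Suc.hyps(2) by (metis binomial_Suc_Suc)
    \<comment> \<open>Chebyshev's inequality needs both weights positive; the first two cases are
      those in which a binomial coefficient vanishes.\<close>
    consider "N < m" | "N = m" | "m < N" by linarith
    then show ?thesis
    proof cases
      case 1
      then have "card A = 0" using le split by (simp add: binomial_eq_0)
      then show ?thesis by simp
    next
      case 2
      then have z: "N choose Suc m = 0" by simp
      then have "card (deletion v A) = 0" "card (deletion v B) = 0" using le by linarith+
      then show ?thesis using 1 split C z fin
        by (simp add: add_mult_distrib trans_le_add1)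
    next
      case 3
      then have "0 < N choose m" "0 < N choose Suc m" by simp_all
      then have "(real (card (link v A)) + real (card (deletion v A))) * (card (link v B) + card (deletion v B)) \<le>
        (card (link v A \<inter> link v B) + card (deletion v A \<inter> deletion v B)) * (real (N choose m) + real (N choose Suc m))"
        using 1 0 dA dB unfolding of_nat_add
        by (intro chebyshev_two) (simp_all flip: of_nat_mult)
      then have "real (card A * card B) \<le> real (card (A \<inter> B) * (card X choose r))"
        using split C fin by simp
      then show ?thesis by (simp only: of_nat_le_iff)
    qed
  qed
qed

section \<open>The difference of two binomial coefficients\<close>

lemma prod_has_field_derivative:
  fixes x :: real
  assumes "finite I"
  shows "((\<lambda>x. \<Prod>i\<in>I. x - real i) has_field_derivative
    (\<Sum>i\<in>I. \<Prod>j\<in>I - {i}. x - real j)) (at x)"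
  by (rule has_field_derivative_prod[where f' = "\<lambda>_. 1", simplified])
    (auto intro!: derivative_eq_intros)

lemma sum_prod_Diff:
  fixes x :: real
  assumes "finite I" "\<And>i. i \<in> I \<Longrightarrow> x \<noteq> real i"
  shows "(\<Sum>i\<in>I. \<Prod>j\<in>I - {i}. x - real j) = (\<Prod>i\<in>I. x - real i) * (\<Sum>i\<in>I. 1 / (x - real i))"
  unfolding sum_distrib_left
proof (rule sum.cong)
  fix i assume "i \<in> I"
  then show "(\<Prod>j\<in>I - {i}. x - real j) = (\<Prod>i\<in>I. x - real i) * (1 / (x - real i))"
    using assms prod.remove[of I i "\<lambda>i. x - real i"] by (simp add: field_simps)
qed simp

text \<open>The derivative of \<open>(x gchoose a) - (x gchoose b)\<close> for \<open>b < a\<close> is a positive multiple of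
  \<open>E\<close> below, and changes sign at most once, from negative to positive.\<close>

lemma gbinomial_diff_quasiconvex:
  fixes a b :: nat
  assumes "b < a"
  obtains f' where
    "\<And>x. real a - 1 < x \<Longrightarrow> ((\<lambda>x. (x gchoose a) - (x gchoose b)) has_field_derivative f' x) (at x)"
    "\<And>x y. real a - 1 < x \<Longrightarrow> x \<le> y \<Longrightarrow> 0 < f' x \<Longrightarrow> 0 < f' y"
proof -
  \<comment> \<open>\<open>Q x\<close> is \<open>x gchoose b\<close> and \<open>Q x * R x\<close> is
    \<open>x gchoose a\<close>. With \<open>S\<close> the logarithmic derivative of \<open>Q\<close>
    and \<open>D\<close> the derivative of \<open>R\<close>, the derivative of
    \<open>Q x * (R x - 1)\<close> is \<open>Q x * E x\<close>.\<close>
  define I where "I = {b..<a}"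
  define Q where "Q x = (\<Prod>i\<in>{0..<b}. x - real i) / fact b" for x
  define S where "S x = (\<Sum>i\<in>{0..<b}. 1 / (x - real i))" for x
  define c where "c = (fact b / fact a :: real)"
  define R where "R x = c * (\<Prod>i\<in>I. x - real i)" for x
  define D where "D x = c * (\<Sum>i\<in>I. \<Prod>j\<in>I - {i}. x - real j)" for x
  define E where "E x = S x * (R x - 1) + D x" for x
  have f: "(\<lambda>x. (x gchoose a) - (x gchoose b)) = (\<lambda>x. Q x * (R x - 1))"
  proof
    fix x :: real
    have "{0..<a} = {0..<b} \<union> I" using assms by (auto simp: I_def)
    then have "(\<Prod>i=0..<a. x - real i) = (\<Prod>i=0..<b. x - real i) * (\<Prod>i\<in>I. x - real i)"
      by (simp add: I_def prod.union_disjoint)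
    then have "x gchoose a = Q x * R x"
      by (simp add: gbinomial_prod_rev Q_def R_def c_def)
    moreover have "x gchoose b = Q x" by (simp add: gbinomial_prod_rev Q_def)
    ultimately show "(x gchoose a) - (x gchoose b) = Q x * (R x - 1)"
      by (simp add: algebra_simps)
  qed
  have c: "c > 0" by (simp add: c_def)
  have pos: "0 < x - real i" if "real a - 1 < x" "i < a" for x i using that by linarith
  have Qpos: "0 < Q x" if "real a - 1 < x" for x
    unfolding Q_def using pos[OF that] assms by (intro divide_pos_pos prod_pos) auto
  have Q': "(Q has_field_derivative Q x * S x) (at x)" if "real a - 1 < x" for x
  proof -
    have "x \<noteq> real i" if "i \<in> {0..<b}" for i using pos[OF \<open>real a - 1 < x\<close>, of i] that assms by auto
    then show ?thesis
      using DERIV_cdivide[OF prod_has_field_derivative[of "{0..<b}" x], of "fact b"]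
        sum_prod_Diff[of "{0..<b}" x]
      by (simp add: Q_def[abs_def] S_def)
  qed
  have R': "(R has_field_derivative D x) (at x)" for x
    unfolding R_def[abs_def] D_def by (intro DERIV_cmult prod_has_field_derivative) (simp add: I_def)
  have deriv: "((\<lambda>x. Q x * (R x - 1)) has_field_derivative Q x * E x) (at x)" if "real a - 1 < x" for x
    by (rule derivative_eq_intros Q'[OF that] R' refl)+ (simp add: E_def algebra_simps)
  have Dpos: "0 < D x" if "real a - 1 < x" for x
    unfolding D_def using c pos[OF that] assms
    by (intro mult_pos_pos sum_pos prod_pos) (auto simp: I_def)
  have mono: "S y \<le> S x" "R x \<le> R y" "D x \<le> D y" if "real a - 1 < x" "x \<le> y" for x y
  proof -
    have le: "0 \<le> x - real i" "x - real i \<le> y - real i" if "i < a" for i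
      using pos[OF \<open>real a - 1 < x\<close> that] \<open>x \<le> y\<close> by auto
    show "S y \<le> S x"
      unfolding S_def using pos[OF that(1)] that(2) assms by (intro sum_mono frac_le) auto
    show "R x \<le> R y"
      unfolding R_def using le c by (intro mult_left_mono prod_mono) (auto simp: I_def)
    show "D x \<le> D y"
      unfolding D_def using le c by (intro mult_left_mono sum_mono prod_mono) (auto simp: I_def)
  qed
  have Spos: "0 \<le> S x" if "real a - 1 < x" for x
    unfolding S_def using pos[OF that] assms by (intro sum_nonneg) (auto intro!: less_imp_le)
  \<comment> \<open>If \<open>R y \<ge> 1\<close>, then \<open>D y > 0\<close> decides the sign.
    Otherwise \<open>R - 1\<close> is negative and does not decrease while \<open>S\<close> does not
    increase, so neither \<open>S * (R - 1)\<close> nor \<open>D\<close> decreases from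
    \<open>x\<close> to \<open>y\<close>.\<close>
  have sign: "0 < E y" if "real a - 1 < x" "x \<le> y" "0 < E x" for x y
  proof (cases "1 \<le> R y")
    case True
    then show ?thesis using Dpos[of y] Spos[of y] that by (simp add: E_def add_nonneg_pos)
  next
    case False
    have "S x * (R x - 1) \<le> S x * (R y - 1)"
      using mono(2)[OF that(1,2)] Spos[OF that(1)] by (intro mult_left_mono) auto
    also have "\<dots> \<le> S y * (R y - 1)"
      using mono(1)[OF that(1,2)] False by (intro mult_right_mono_neg) auto
    finally show ?thesis using mono(3)[OF that(1,2)] that(3) by (simp add: E_def)
  qed
  show thesis
  proof (rule that)
    show "((\<lambda>x. (x gchoose a) - (x gchoose b)) has_field_derivative Q x * E x) (at x)"
      if "real a - 1 < x" for x
      unfolding f using deriv[OF that] .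
    show "0 < Q y * E y" if "real a - 1 < x" "x \<le> y" "0 < Q x * E x" for x y
      using sign[OF that(1,2)] Qpos[of x] Qpos[of y] that
      by (simp add: zero_less_mult_iff)
  qed
qed

text \<open>By Pascal's rule the increments of the two coefficients have upper entry
  \<open>a + b - 2\<close> and lower entries \<open>a - 1\<close> and \<open>b - 1\<close>; these
  are equal by symmetry.\<close>

lemma gbinomial_diff_equal:
  assumes "0 < a" "0 < b" "2 \<le> a + b"
  shows "((a + b - 1) choose a) + ((a + b - 2) choose b) = ((a + b - 1) choose b) + ((a + b - 2) choose a)"
proof -
  obtain a' b' where ab: "a = Suc a'" "b = Suc b'" using assms by (metis Suc_pred)
  have "(a' + b') choose a' = (a' + b') choose b'"
    by (metis add_diff_cancel_left' binomial_symmetric le_add1)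
  then show ?thesis by (simp add: ab)
qed

text \<open>The two points \<open>a + b - 2\<close> and \<open>a + b - 1\<close> have the same value, so to the left of the first
  one the function must be decreasing.\<close>

lemma gbinomial_diff_le:
  fixes x y :: real
  assumes "b < a" "real a \<le> y" "y \<le> real (a + b) - 2" "y \<le> x" "x \<le> real (a + b) - 1"
  shows "(x gchoose a) - (x gchoose b) \<le> (y gchoose a) - (y gchoose b)"
proof (rule ccontr)
  define f :: "real \<Rightarrow> real" where "f = (\<lambda>x. (x gchoose a) - (x gchoose b))"
  assume "\<not> ?thesis"
  then have gt: "f y < f x" by (simp add: f_def)
  obtain f' where f': "\<And>x. real a - 1 < x \<Longrightarrow> (f has_field_derivative f' x) (at x)"
    and sign: "\<And>x y. real a - 1 < x \<Longrightarrow> x \<le> y \<Longrightarrow> 0 < f' x \<Longrightarrow> 0 < f' y"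
    using gbinomial_diff_quasiconvex[OF assms(1)] unfolding f_def by metis
  have increase: "\<exists>z>u. z < v \<and> f v - f u = (v - u) * f' z" if "u < v" "y \<le> u" for u v
    using MVT2[OF that(1), of f f'] f' that assms(2) by force
  define z where "z = real (a + b - 1)"
  define w where "w = real (a + b - 2)"
  have "2 \<le> b" using assms by linarith
  then have zw: "z = real (a + b) - 1" "w = real (a + b) - 2" using assms(1) by (auto simp: z_def w_def)
  have "f z = f w"
  proof -
    have "real ((a + b - 1) choose a) + real ((a + b - 2) choose b) =
      real ((a + b - 1) choose b) + real ((a + b - 2) choose a)"
      using gbinomial_diff_equal[of a b] \<open>2 \<le> b\<close> assms(1) by (simp flip: of_nat_add)
    then show ?thesis by (simp add: f_def z_def w_def binomial_gbinomial)
  qed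
  \<comment> \<open>Once \<open>f\<close> rises somewhere, its derivative is positive at a mean
    value point there, hence at every point to the right by \<open>sign\<close>.\<close>
  have inc: "f u < f v"
    if *: "y \<le> s" "s < t" "f s < f t" "s \<le> u" "t \<le> u" "u < v" for s t u v
  proof -
    obtain p where p: "s < p" "p < t" "f t - f s = (t - s) * f' p"
      using increase[OF *(2,1)] by blast
    then have "0 < f' p" using * by (smt (verit) zero_less_mult_iff)
    have "y \<le> u" using * by linarith
    then obtain q where q: "u < q" "f v - f u = (v - u) * f' q"
      using increase[OF *(6)] by blast
    have "0 < f' q" using sign[of p q] p q \<open>0 < f' p\<close> * assms(2) by linarith
    then show ?thesis using q * by (smt (verit) mult_pos_pos)
  qed
  have "y < x" using gt assms(4) by (cases "x = y") auto
  \<comment> \<open>The rise from \<open>y\<close> to \<open>x\<close> persists up to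
    \<open>z\<close>. As \<open>f z = f w\<close>, there is also a rise from \<open>y\<close> to
    \<open>w\<close>, hence one from \<open>w\<close> to \<open>z\<close>, a contradiction.\<close>
  have "f x \<le> f z" using inc[of y x x z] gt \<open>y < x\<close> assms zw by (cases "x = z") force+
  then have "f y < f w" using gt \<open>f z = f w\<close> by simp
  then have "y < w" using assms(3) zw by (cases "y = w") auto
  then show False using inc[of y w w z] \<open>f y < f w\<close> \<open>f z = f w\<close> zw by simp
qed

section \<open>Families of small diversity\<close>

lemma intersectingD: "intersecting F \<Longrightarrow> A \<in> F \<Longrightarrow> B \<in> F \<Longrightarrow> A \<inter> B \<noteq> {}"
  by (simp add: intersecting_def)

lemma cross_link_deletion: "intersecting F \<Longrightarrow> cross (link i F) (deletion i F)"
  by (fastforce simp: intersecting_def cross_def link_def deletion_def)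

lemma cross_link_links:
  assumes "intersecting F" "i \<noteq> j"
  shows "cross (link i (deletion j F)) (link j (deletion i F))"
  unfolding cross_def
proof (intro ballI)
  fix Y Z assume "Y \<in> link i (deletion j F)" "Z \<in> link j (deletion i F)"
  then show "Y \<inter> Z \<noteq> {}"
    using intersectingD[OF assms(1), of "insert i Y" "insert j Z"] assms(2)
    by (auto simp: link_def deletion_def)
qed

lemma cross_links_deletions:
  assumes "intersecting F"
  shows "cross (link i (link j F)) (deletion i (deletion j F))"
  unfolding cross_def
proof (intro ballI)
  fix Y Z assume "Y \<in> link i (link j F)" "Z \<in> deletion i (deletion j F)"
  then show "Y \<inter> Z \<noteq> {}"
    using intersectingD[OF assms(1), of "insert j (insert i Y)" Z]
    by (auto simp: link_def deletion_def)
qed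

lemma cross_bound_nat:
  assumes "finite X" "A \<subseteq> nsets X s" "B \<subseteq> nsets X r" "cross A B" "r + s \<le> card X"
    and "q choose (card X - r) < card B"
  shows "card A + (q choose s) \<le> card X choose s"
proof -
  \<comment> \<open>If \<open>q\<close> is below \<open>card X - r\<close>, its coefficient vanishes
    and \<open>B\<close> is merely known to be nonempty; this suffices for the value
    \<open>card X - r\<close>, whose coefficient is 1.\<close>
  define p where "p = max q (card X - r)"
  have "p choose (card X - r) \<le> card B" using assms(6) by (auto simp: p_def max_def binomial_eq_0)
  then have "card A + (p choose s) \<le> card X choose s"
    using cross_bound[OF assms(1-5), of "real p"]
    by (simp add: p_def flip: binomial_gbinomial of_nat_add)
  moreover have "q choose s \<le> p choose s" by (simp add: p_def binomial_right_mono)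
  ultimately show ?thesis by linarith
qed

text \<open>From here on \<open>n = a + b + 2\<close> and \<open>k = b + 1\<close>, so that \<open>n - k - 1 = a\<close> and \<open>k - 1 = b\<close>.\<close>

lemma intersecting_card_bound:
  fixes y :: real
  assumes "card X = a + b + 2" "F \<subseteq> nsets X (Suc b)" "intersecting F" "i \<in> X" "b < a"
    and "real a \<le> y" "y \<le> real (a + b) - 2"
    and "y gchoose a \<le> card (deletion i F)" "card (deletion i F) \<le> (a + b - 1) choose a"
  shows "card F + (y gchoose b) \<le> ((a + b + 1) choose b) + (y gchoose a)"
proof -
  have X: "finite X" using assms(1) by (metis add_is_0 card.infinite zero_neq_numeral)
  then have cX: "card (X - {i}) = a + b + 1" using assms(1,4) by simp
  define z where "z = real (a + b - 1)"
  have z: "y \<le> z" "z = real (a + b) - 1" using assms(5,7) by (auto simp: z_def)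
  \<comment> \<open>The intermediate value theorem yields \<open>x\<close> whose coefficient is
    exactly the number of sets avoiding \<open>i\<close>. The cross bound estimates the link at this
    \<open>x\<close>, and \<open>gbinomial_diff_le\<close> passes from \<open>x\<close> to
    \<open>y\<close>.\<close>
  have "continuous_on {y..z} (\<lambda>x. x gchoose a)"
    unfolding gbinomial_prod_rev by (intro continuous_intros) auto
  moreover have "card (deletion i F) \<le> z gchoose a" using assms(9) by (simp add: z_def flip: binomial_gbinomial)
  ultimately obtain x where x: "y \<le> x" "x \<le> z" "x gchoose a = card (deletion i F)"
    using IVT'[of "\<lambda>x. x gchoose a" y "real (card (deletion i F))" z] assms(8) z(1) by blast
  have "card (link i F) + (x gchoose b) \<le> (a + b + 1) choose b"
    using cross_bound[of "X - {i}" "link i F" b "deletion i F" "Suc b" x] X cX link_nsets[OF assms(2)]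
      deletion_nsets[OF assms(2)] cross_link_deletion[OF assms(3)] x assms(5,6)
    by simp
  moreover have "card F = card (link i F) + card (deletion i F)"
    using assms(2) X by (intro card_link_deletion) (rule finite_nsets_sub)
  moreover have "(x gchoose a) - (x gchoose b) \<le> (y gchoose a) - (y gchoose b)"
    using gbinomial_diff_le[of b a y x] assms x z by simp
  ultimately show ?thesis using x(3) by simp
qed

lemma intersecting_card_bound_nat:
  assumes "card X = a + b + 2" "F \<subseteq> nsets X (Suc b)" "intersecting F" "i \<in> X" "2 \<le> b" "b < a"
    and "(a + b - 2) choose a \<le> card (deletion i F)" "card (deletion i F) \<le> (a + b - 1) choose a"
  shows "card F + ((a + b - 2) choose b) \<le> ((a + b + 1) choose b) + ((a + b - 2) choose a)"
proof -
  define q where "q = a + b - 2"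
  have q: "real q = real (a + b) - 2" using assms(5) by (simp add: q_def)
  have "real q gchoose a \<le> card (deletion i F)"
    using assms(7) by (simp add: q_def flip: binomial_gbinomial)
  then have "card F + (real q gchoose b) \<le> ((a + b + 1) choose b) + (real q gchoose a)"
    using assms q by (intro intersecting_card_bound[of X a b F i]) simp_all
  then show ?thesis by (simp flip: binomial_gbinomial of_nat_add q_def)
qed

text \<open>Two disjoint sets in the link, together with \<open>v\<close>, leave some
  \<open>x \<in> X\<close> uncovered; moving \<open>v\<close> to \<open>x\<close> in one of them
  gives two disjoint members of \<open>F\<close>.\<close>

lemma intersecting_shifted_link:
  fixes X :: "'a::linorder set"
  assumes "finite X" "F \<subseteq> nsets X (Suc b)" "2 * b + 1 < card X" "shifted_on X F"
    "intersecting F" "v \<in> X" "\<And>x. x \<in> X \<Longrightarrow> x \<le> v"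
  shows "intersecting (link v F)"
  unfolding intersecting_def
proof (intro ballI notI)
  fix G H assume G: "G \<in> link v F" and H: "H \<in> link v F" and e: "G \<inter> H = {}"
  have "card G = b" "card H = b" "finite G" "finite H"
    using G H assms(2) link_nsets[OF assms(2), of v] by (auto simp: nsets_def)
  then have "card (insert v (G \<union> H)) \<le> 2 * b + 1"
    using card_Un_le[of G H] card_insert_le_m1[of "2 * b + 1" "G \<union> H" v] by simp
  then have "\<not> X \<subseteq> insert v (G \<union> H)"
    using assms(3) card_mono[of "insert v (G \<union> H)" X] \<open>finite G\<close> \<open>finite H\<close> by auto
  then obtain x where x: "x \<in> X" "x \<noteq> v" "x \<notin> G" "x \<notin> H" by blast
  then have "insert x (insert v G - {v}) \<in> F"
    using G assms(6,7) by (intro shifted_onD[OF assms(4)]) (auto simp: link_def le_neq_trans)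
  moreover have "insert x (insert v G - {v}) \<inter> insert v H = {}" using x e G by (auto simp: link_def)
  moreover have "insert v H \<in> F" using H by (auto simp: link_def)
  ultimately show False using assms(5) unfolding intersecting_def by blast
qed

text \<open>An induction on \<open>n\<close>, splitting off the last element: the bound exceeded by \<open>card F\<close> satisfies
  Pascal's recurrence. When one of the two parts exceeds its bound, the other one is controlled by
  cross-intersection.\<close>

lemma shifted_dichotomy:
  assumes "F \<subseteq> nsets {1..a + b + 2} (Suc b)" "intersecting F" "shifted_on {1..a + b + 2} F" "b \<le> a"
    and "((a + b + 1) choose b) + ((a + b - 2) choose a) < card F + ((a + b - 2) choose b)"
  shows "card (deletion 1 F) \<le> (a + b - 2) choose a"
  using assms
proof (induction "a + b" arbitrary: a b F rule: less_induct)
  case less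
  note Fn = less.prems(1) and FI = less.prems(2) and FS = less.prems(3) and ba = less.prems(4)
    and big = less.prems(5)
  define n where "n = a + b + 2"
  have Fn': "F \<subseteq> nsets {1..n} (Suc b)" and FS': "shifted_on {1..n} F"
    using Fn FS by (simp_all add: n_def)
  have fF: "finite F" using Fn finite_nsets_sub by blast
  consider "b = 0" | "b = a" "b > 0" | "0 < b" "b < a" using ba by linarith
  then show ?case
  proof cases
    case 1
    have "deletion 1 F = {}"
    proof (rule equals0I)
      fix Y assume Y: "Y \<in> deletion 1 F"
      then have "Y \<in> nsets {1..n} 1" using Fn' 1 by (auto simp: deletion_def)
      then obtain p where p: "Y = {p}" "p \<in> {1..n}" by (auto simp: nsets_def card_1_singleton_iff)
      then have "insert 1 (Y - {p}) \<in> F"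
        using Y by (intro shifted_onD[OF FS']) (auto simp: deletion_def)
      then have "{1} \<inter> {p} \<noteq> {}" "p \<noteq> 1"
        using p Y intersectingD[OF FI, of "{1}" "{p}"] by (auto simp: deletion_def)
      then show False by auto
    qed
    then show ?thesis by simp
  next
    case 2
    \<comment> \<open>The members have half the size of the ground set, so at most half of all such
      sets occur, against \<open>big\<close>.\<close>
    have "card F + card F \<le> card {1..n} choose (Suc b)"
      using FI Fn' 2 by (intro cross_sum_bound) (auto simp: cross_def intersecting_def n_def)
    also have "card {1..n} choose (Suc b) = 2 * ((a + b + 1) choose b)"
      using 2 binomial_symmetric[of b "Suc (2 * b)"] by (simp add: n_def mult_2 numeral_2_eq_2)
    finally show ?thesis using big 2 by simp
  next
    case 3
    obtain a' b' where ab: "a = Suc a'" "b = Suc b'" using 3 by (metis Suc_pred less_trans)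
    have le: "b' < a'" "0 < a'" using ab 3 by auto
    obtain a'' where a'': "a' = Suc a''" using le by (metis Suc_pred)
    define X where "X = {1..n - 1}"
    have X: "{1..n} - {n} = X" "card X = a + b + 1" "finite X" "1 \<in> X"
      by (auto simp: X_def n_def)
    have X1: "card (X - {1}) = a + b" "finite (X - {1})" using X by auto
    let ?D = "deletion n F" and ?L = "link n F"
    have D: "?D \<subseteq> nsets X (Suc b)" "shifted_on X ?D" "intersecting ?D"
      using deletion_nsets[OF Fn', of n] shifted_on_deletion[OF FS', of n] FI X
      by (auto simp: intersecting_def deletion_def)
    have L: "?L \<subseteq> nsets X (Suc b')" "shifted_on X ?L"
      using link_nsets[of F "{1..n}" b n] Fn' shifted_on_link[OF FS', of n] X ab by auto
    have LI: "intersecting ?L"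
      using Fn' FS' FI 3 by (intro intersecting_shifted_link[of "{1..n}" F b]) (auto simp: n_def)
    have X': "X = {1..a' + b + 2}" "X = {1..a + b' + 2}" using ab by (auto simp: X_def n_def)
    have fD: "finite ?D" and fL: "finite ?L" using fF by (simp_all add: finite_deletion finite_link)
    have split: "card F = card ?L + card ?D" "card ?D = card (link 1 ?D) + card (deletion 1 ?D)"
      "card ?L = card (link 1 ?L) + card (deletion 1 ?L)"
      "card (deletion 1 F) = card (deletion 1 ?L) + card (deletion 1 ?D)"
      using card_link_deletion[OF fF, of n] card_link_deletion[OF fD, of 1] card_link_deletion[OF fL, of 1]
        card_deletion_split[OF fF, of 1 n] link_deletion[of n 1 F] by (simp_all add: n_def)
    have c1: "cross (link 1 ?D) (deletion 1 ?L)"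
      using cross_link_links[OF FI, of 1 n] link_deletion[of n 1 F] by (simp add: n_def)
    have c2: "cross (link 1 ?L) (deletion 1 ?D)"
      using cross_links_deletions[OF FI] .
    have pas: "(a + b + 1) choose b = ((a + b) choose b) + ((a + b) choose b')"
      "(a + b - 2) choose a = ((a + b - 3) choose a') + ((a + b - 3) choose a)"
      "(a + b - 2) choose b = ((a + b - 3) choose b') + ((a + b - 3) choose b)"
      "(a + b - 1) choose a = ((a + b - 2) choose a') + ((a + b - 2) choose a)"
      using ab a'' by (simp_all add: numeral_eq_Suc)
    have mono: "(a + b - 3) choose i \<le> (a + b - 2) choose i" for i by (intro binomial_right_mono) auto
    \<comment> \<open>A weaker bound first. By Pascal's rule the deletion of \<open>n\<close>
      (parameters \<open>a - 1\<close>, \<open>b\<close>) or its link (parameters \<open>a\<close>,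
      \<open>b - 1\<close>) exceeds its own bound, and the induction hypothesis applies to that
      part.\<close>
    have "card (deletion 1 F) \<le> (a + b - 1) choose a"
    proof (cases "((a' + b + 1) choose b) + ((a' + b - 2) choose a') < card ?D + ((a' + b - 2) choose b)")
      case True
      then have d: "card (deletion 1 ?D) \<le> (a' + b - 2) choose a'"
        using less.hyps[of a' b ?D] D X' ab le by simp
      \<comment> \<open>Otherwise cross-intersection would limit \<open>link 1 ?D\<close> so far
        that \<open>?D\<close> could not exceed its bound.\<close>
      have "card (deletion 1 ?L) \<le> (a + b - 2) choose a"
      proof (rule ccontr)
        assume "\<not> ?thesis"
        then have "card (link 1 ?D) + ((a + b - 2) choose b) \<le> (a + b) choose b"
          using cross_bound_nat[of "X - {1}" "link 1 ?D" b "deletion 1 ?L" b "a + b - 2"] X1 c1 3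
            link_nsets[OF D(1), of 1] deletion_nsets[OF L(1), of 1] ab by simp
        then show False using True d split mono[of b] ab by simp
      qed
      then show ?thesis using d mono[of a'] split pas ab by simp
    next
      case False
      then have gt: "((a + b' + 1) choose b') + ((a + b' - 2) choose a) < card ?L + ((a + b' - 2) choose b')"
        using big split(1) pas ab by simp
      then have d: "card (deletion 1 ?L) \<le> (a + b' - 2) choose a"
        using less.hyps[of a b' ?L] L LI X' ab le by simp
      \<comment> \<open>The same argument with the roles of link and deletion exchanged.\<close>
      have "card (deletion 1 ?D) \<le> (a + b - 2) choose a'"
      proof (rule ccontr)
        assume "\<not> ?thesis"
        then have "card (link 1 ?L) + ((a + b - 2) choose b') \<le> (a + b) choose b'"
          using cross_bound_nat[of "X - {1}" "link 1 ?L" b' "deletion 1 ?D" "Suc b" "a + b - 2"] X1 c2 3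
            link_nsets[OF L(1), of 1] deletion_nsets[OF D(1), of 1] ab by simp
        then show False using gt d split mono[of b'] ab by simp
      qed
      then show ?thesis using d mono[of a] split pas ab by simp
    qed
    note c2bound = this
    \<comment> \<open>Between the two coefficients the general bound on \<open>card F\<close>
      contradicts \<open>big\<close>. It needs \<open>a \<le> a + b - 2\<close>, so
      \<open>b = 1\<close> is separate: there a single 2-set avoids \<open>1\<close>, and hence at
      most two members contain \<open>1\<close>.\<close>
    show ?thesis
    proof (rule ccontr)
      assume neg: "\<not> ?thesis"
      show False
      proof (cases "b = 1")
        case True
        then have g: "card (deletion 1 F) = 1" using c2bound neg 3 by (simp add: binomial_eq_0)
        have "card (link 1 F) + a \<le> a + 2"
          using cross_bound[of "{1..n} - {1}" "link 1 F" 1 "deletion 1 F" 2 "real a"] True g 3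
            link_nsets[of F "{1..n}" 1 1] deletion_nsets[of F "{1..n}" 2 1] Fn' cross_link_deletion[OF FI, of 1]
            binomial_gbinomial[of a a, where ?'a = real]
          by (simp add: n_def numeral_2_eq_2)
        then show False using g big True card_link_deletion[OF fF, of 1] 3 by (simp add: binomial_eq_0)
      next
        case False
        then have b2: "2 \<le> b" using 3 by simp
        have "card F + ((a + b - 2) choose b) \<le> ((a + b + 1) choose b) + ((a + b - 2) choose a)"
          using neg c2bound b2 3 Fn' FI
          by (intro intersecting_card_bound_nat[of "{1..n}" a b F 1]) (auto simp: n_def)
        then show False using big by simp
      qed
    qed
  qed
qed

section \<open>Shifting a counterexample\<close>

lemma shifted_onI:
  assumes "\<And>a b. a \<in> X \<Longrightarrow> b \<in> X \<Longrightarrow> a < b \<Longrightarrow> shift a b F = F"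
  shows "shifted_on X F"
  unfolding shifted_on_def
proof (intro ballI impI)
  fix a b Y assume "a \<in> X" "b \<in> X" "Y \<in> F" "a < b" "b \<in> Y" "a \<notin> Y"
  then show "insert a (Y - {b}) \<in> F"
    by (intro shift_fixedD[OF assms])
qed

lemma card_link_le: "finite F \<Longrightarrow> card (link v F) \<le> card F"
  using card_link_deletion[of F v] by simp

lemma link_Int: "link v (F \<inter> G) = link v F \<inter> link v G"
  by (auto simp: link_def)

text \<open>Members with traces \<open>{i, p}\<close> and \<open>{j, q}\<close> are disjoint on the
  four points, so they must meet elsewhere.\<close>

lemma cross_opposite_links:
  assumes "intersecting F" "i \<noteq> j" "p \<noteq> q" "i \<noteq> q" "j \<noteq> p"
  shows "cross (link p (deletion q (link i (deletion j F)))) (link q (deletion p (link j (deletion i F))))"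
  unfolding cross_def
proof (intro ballI)
  fix Y Z assume "Y \<in> link p (deletion q (link i (deletion j F)))" "Z \<in> link q (deletion p (link j (deletion i F)))"
  then show "Y \<inter> Z \<noteq> {}"
    using intersectingD[OF assms(1), of "insert i (insert p Y)" "insert j (insert q Z)"] assms(2-)
    by (auto simp: link_def deletion_def)
qed

text \<open>The hypotheses say that both shifts turn \<open>F\<close> almost into a star. Then nearly all members meet
  both \<open>{i, j}\<close> and \<open>{p, q}\<close>, and they are counted by their trace on these four points.\<close>

lemma two_disjoint_collapses:
  assumes "finite X" "card X = a + b + 2" "F \<subseteq> nsets X (Suc b)" "intersecting F" "2 \<le> b" "b < a"
    and X: "i \<in> X" "j \<in> X" "p \<in> X" "q \<in> X"
    and ne: "i \<noteq> j" "i \<noteq> p" "i \<noteq> q" "j \<noteq> p" "j \<noteq> q" "p \<noteq> q"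
    and ij: "card (deletion i (shift i j F)) \<le> (a + b - 2) choose a"
    and pq: "card (deletion p (shift p q F)) \<le> (a + b - 2) choose a"
  shows "card F + ((a + b - 2) choose b) \<le> ((a + b + 1) choose b) + ((a + b - 2) choose a)"
proof -
  obtain c where c: "b = Suc (Suc c)" using assms(5) by (metis Suc_le_D numeral_2_eq_2 Suc_le_mono)
  \<comment> \<open>\<open>m\<close> is the size of the ground set \<open>W\<close> outside the four
    points; members containing exactly three of these points leave \<open>c\<close> elements in
    \<open>W\<close>.\<close>
  define m where "m = a + c"
  have m: "a + b - 2 = m" "a + b + 1 = Suc (Suc (Suc m))" using c by (simp_all add: m_def)
  define W where "W = X - {i} - {j} - {p} - {q}"
  have W: "finite W" "card W = m" using assms(1,2) X ne c by (simp_all add: W_def m_def)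
  have fF: "finite F" using assms(1,3) finite_nsets_sub by blast
  define P where "P = link i (deletion j F)"
  define Q where "Q = link j (deletion i F)"
  define R where "R = link i (link j F)"
  have fPQR: "finite P" "finite Q" "finite R" using fF by (simp_all add: P_def Q_def R_def finite_link finite_deletion)
  have P: "P \<subseteq> nsets (X - {i} - {j}) (Suc (Suc c))"
    and Q: "Q \<subseteq> nsets (X - {i} - {j}) (Suc (Suc c))"
    and R: "R \<subseteq> nsets (X - {i} - {j}) (Suc c)"
    using assms(3) c by (auto simp: P_def Q_def R_def link_def deletion_def nsets_def)
  have sub: "link p (deletion q G) \<subseteq> nsets W r" "link q (deletion p G) \<subseteq> nsets W r"
    if "G \<subseteq> nsets (X - {i} - {j}) (Suc r)" for G r
    using that by (auto simp: W_def link_def deletion_def nsets_def)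
  have sub2: "link p (link q G) \<subseteq> nsets W c" if "G \<subseteq> nsets (X - {i} - {j}) (Suc (Suc c))" for G
    using that by (auto simp: W_def link_def nsets_def)
  \<comment> \<open>Opposite two-point traces cross-intersect, so together they fill at most one
    level of \<open>W\<close>; \<open>b2\<close> treats the other opposite pair.\<close>
  have b1: "card (link p (deletion q P)) + card (link q (deletion p Q)) \<le> m choose Suc c"
    using cross_sum_bound[of W _ "Suc c"] W sub[OF P] sub[OF Q] assms(6) c
      cross_opposite_links[OF assms(4), of i j p q] ne by (simp add: P_def Q_def m_def)
  have b2: "card (link q (deletion p P)) + card (link p (deletion q Q)) \<le> m choose Suc c"
    using cross_sum_bound[of W _ "Suc c"] W sub[OF P] sub[OF Q] assms(6) c
      cross_opposite_links[OF assms(4), of i j q p] ne by (simp add: P_def Q_def m_def)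
  \<comment> \<open>Traces with \<open>p\<close>, \<open>q\<close> and exactly one of
    \<open>i\<close>, \<open>j\<close>: their union fits into one level, and the overlap is charged
    to \<open>P \<inter> Q\<close>, which \<open>ij\<close> controls.\<close>
  have b3: "card (link p (link q P)) + card (link p (link q Q)) \<le> (m choose c) + card (P \<inter> Q)"
  proof -
    have "card (link p (link q P) \<union> link p (link q Q)) \<le> m choose c"
      using card_nsets_le[of "link p (link q P) \<union> link p (link q Q)" W c] W sub2[OF P] sub2[OF Q] by simp
    moreover have "card (link p (link q P) \<inter> link p (link q Q)) \<le> card (P \<inter> Q)"
      using card_link_le[of "link q (P \<inter> Q)" p] card_link_le[of "P \<inter> Q" q] fPQR
      by (simp add: link_Int finite_link)
    ultimately show ?thesis
      using card_Un_Int[of "link p (link q P)" "link p (link q Q)"] fPQR by (simp add: finite_link)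
  qed
  \<comment> \<open>Traces with \<open>i\<close>, \<open>j\<close> and at least one of
    \<open>p\<close>, \<open>q\<close>: the shift merges them into one link, and the overlap is
    charged to the analogous intersection for \<open>p\<close> and \<open>q\<close>, which
    \<open>pq\<close> controls.\<close>
  have b4: "card (link p (link q R)) + card (link p (deletion q R)) + card (link q (deletion p R)) \<le>
    (Suc m choose c) + card (link p (deletion q F) \<inter> link q (deletion p F))"
  proof -
    have "shift p q R \<subseteq> nsets (X - {i} - {j}) (Suc c)"
      using R X ne by (intro shift_nsets) auto
    then have "link p (shift p q R) \<subseteq> nsets (X - {i} - {j} - {p}) c" by (rule link_nsets)
    then have "card (link p (shift p q R)) \<le> Suc m choose c"
      using card_nsets_le[of _ "X - {i} - {j} - {p}" c] assms(1,2) X ne c by (simp add: m_def)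
    moreover have "card (link p (shift p q R)) = card (link p (link q R)) + card (link p (deletion q R) \<union> link q (deletion p R))"
    proof -
      have "link q (link p (shift p q R)) = link p (link q R)"
        by (rule trans[OF link_link shift_link_link[OF ne(6)]])
      moreover have "deletion q (link p (shift p q R)) = link p (deletion q R) \<union> link q (deletion p R)"
        by (rule trans[OF link_deletion[symmetric, OF ne(6)] shift_link_deletion[OF ne(6)]])
      ultimately show ?thesis
        using card_link_deletion[of "link p (shift p q R)" q] fPQR by (simp add: finite_link finite_shift)
    qed
    moreover have "card (link p (deletion q R) \<inter> link q (deletion p R)) \<le> card (link p (deletion q F) \<inter> link q (deletion p F))"
    proof -
      let ?I = "link p (deletion q F) \<inter> link q (deletion p F)"
      have "link p (deletion q R) \<inter> link q (deletion p R) = link i (link j ?I)"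
        unfolding R_def link_def deletion_def using ne by (auto simp: insert_commute)
      moreover have "card (link i (link j ?I)) \<le> card ?I"
        using card_link_le[of "link j ?I" i] card_link_le[of ?I j] fF by (simp add: finite_link finite_deletion)
      ultimately show ?thesis by simp
    qed
    ultimately show ?thesis
      using card_Un_Int[of "link p (deletion q R)" "link q (deletion p R)"] fPQR by (simp add: finite_link finite_deletion)
  qed
  \<comment> \<open>Members meeting \<open>{i, j}\<close> but avoiding \<open>p\<close> and
    \<open>q\<close> are few by \<open>pq\<close>.\<close>
  have b5: "card (deletion p (deletion q P)) + card (deletion p (deletion q Q)) + card (deletion p (deletion q R)) \<le> card (deletion p (deletion q F))"
  proof -
    have "deletion p (deletion q P) = link i (deletion j (deletion p (deletion q F)))" "deletion p (deletion q Q) = link j (deletion i (deletion p (deletion q F)))"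
      "deletion p (deletion q R) = link i (link j (deletion p (deletion q F)))"
      using ne by (auto simp: P_def Q_def R_def link_def deletion_def)
    then show ?thesis
      using card_four[of "deletion p (deletion q F)" i j] fF ne by (simp add: finite_deletion)
  qed
  have F: "card F = card R + card P + card Q + card (deletion i (deletion j F))"
    using card_four[OF fF ne(1)] by (simp add: P_def Q_def R_def)
  note s = card_four[OF fPQR(1) ne(6)] card_four[OF fPQR(2) ne(6)] card_four[OF fPQR(3) ne(6)]
  have "card (deletion i (deletion j F)) + card (P \<inter> Q) \<le> m choose a"
    using ij card_deletion_shift[OF fF ne(1)] m by (simp add: P_def Q_def)
  moreover have "card (deletion p (deletion q F)) + card (link p (deletion q F) \<inter> link q (deletion p F)) \<le> m choose a"
    using pq card_deletion_shift[OF fF ne(6)] m by simp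
  moreover have "m choose a = m choose c"
    using binomial_symmetric[of a m] by (simp add: m_def)
  \<comment> \<open>Repeated use of Pascal's rule makes the target comparable with the sum of the
    estimates, which stays below it.\<close>
  moreover have "Suc (Suc (Suc m)) choose b =
    (m choose b) + 3 * (m choose Suc c) + 2 * (m choose c) + (Suc m choose c)"
    using c by (cases c) simp_all
  moreover have "card P + card Q + card R + card (deletion i (deletion j F)) \<le>
    2 * (m choose Suc c) + (m choose c) + (Suc m choose c) +
    (card (deletion i (deletion j F)) + card (P \<inter> Q)) +
    (card (deletion p (deletion q F)) + card (link p (deletion q F) \<inter> link q (deletion p F)))"
    using b1 b2 b3 b4 b5 unfolding s by linarith
  ultimately show ?thesis unfolding F m by linarith
qed

text \<open>By positive correlation the traces \<open>P\<close> and \<open>Q\<close> of \<open>F\<close> on \<open>{i}\<close> and \<open>{j}\<close> have a large intersection.\<close>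

lemma no_collapse_of_shifted:
  fixes X :: "'a::linorder set"
  assumes "finite X" "card X = a + b + 2" "F \<subseteq> nsets X (Suc b)" "2 \<le> b" "b < a"
    and "i \<in> X" "j \<in> X" "i \<noteq> j" "shifted_on (X - {i, j}) F"
    and di: "(a + b - 1) choose a < card (deletion i F)" and dj: "(a + b - 1) choose a < card (deletion j F)"
  shows "(a + b - 2) choose a \<le> card (deletion i (shift i j F))"
proof (rule ccontr)
  assume neg: "\<not> ?thesis"
  have fF: "finite F" using assms(1,3) finite_nsets_sub by blast
  define P where "P = link i (deletion j F)"
  define Q where "Q = link j (deletion i F)"
  define Y where "Y = X - {i, j}"
  have Y: "finite Y" "card Y = a + b" using assms(1,2,6-8) by (simp_all add: Y_def card_Diff_subset)
  have "P \<subseteq> nsets Y b" "Q \<subseteq> nsets Y b"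
    using assms(3) by (auto simp: P_def Q_def Y_def link_def deletion_def nsets_def)
  \<comment> \<open>\<open>i\<close> and \<open>j\<close> lie outside \<open>Y\<close>, so links and
    deletions at them do not shrink the set on which shiftedness holds.\<close>
  moreover have "Y - {v} = Y" if "v = i \<or> v = j" for v using that by (auto simp: Y_def)
  then have "shifted_on Y P" "shifted_on Y Q"
    using shifted_on_link[OF shifted_on_deletion[of Y F j], of i] shifted_on_link[OF shifted_on_deletion[of Y F i], of j]
      assms(9) by (simp_all add: P_def Q_def Y_def[symmetric])
  ultimately have corr: "card P * card Q \<le> card (P \<inter> Q) * ((a + b) choose b)"
    using shifted_correlation[OF Y(1), of P b Q] Y(2) by simp
  \<comment> \<open>\<open>T\<close>, \<open>c2\<close>, \<open>c3\<close> have upper entries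
    \<open>n - 2\<close>, \<open>n - 3\<close>, \<open>n - 4\<close>; absorption gives the ratios of
    consecutive ones. \<open>N\<close> counts the members avoiding both points.\<close>
  define N where "N = real (card (deletion i (deletion j F)))"
  define c2 where "c2 = real ((a + b - 1) choose a)"
  define c3 where "c3 = real ((a + b - 2) choose a)"
  define T where "T = real ((a + b) choose b)"
  obtain c where c: "b = Suc (Suc c)" using assms(4) by (metis Suc_le_D numeral_2_eq_2 Suc_le_mono)
  have "(a + b) * ((a + b - 1) choose a) = ((a + b) choose b) * b"
    using Suc_times_binomial_eq[of "a + Suc c" "Suc c"] binomial_symmetric[of a "a + Suc c"] c by simp
  then have T: "(real a + real b) * c2 = T * b" by (simp add: T_def c2_def flip: of_nat_mult of_nat_add)
  have "(a + b - 1) * ((a + b - 2) choose a) = ((a + b - 1) choose a) * (b - 1)"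
    using Suc_times_binomial_eq[of "a + c" "c"] binomial_symmetric[of a "a + c"]
      binomial_symmetric[of a "a + Suc c"] c by simp
  then have "real (a + b - 1) * c3 = c2 * real (b - 1)"
    by (simp add: c3_def c2_def flip: of_nat_mult)
  then have c3: "(real a + real b - 1) * c3 = c2 * (real b - 1)" using c by simp
  have "0 < c2" using assms(4) by (simp add: c2_def)
  have PN: "c2 < card P + N"
    using dj card_deletion_split[OF fF, of j i] assms(8) deletion_deletion[of j i F] by (simp add: P_def N_def c2_def)
  have QN: "c2 < card Q + N"
    using di card_deletion_split[OF fF, of i j] assms(8) by (simp add: Q_def N_def c2_def)
  have IN: "card (P \<inter> Q) + N < c3"
    using neg card_deletion_shift[OF fF assms(8)] by (simp add: P_def Q_def N_def c3_def)
  have "0 \<le> N" by (simp add: N_def)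
  have "c3 \<le> c2" unfolding c2_def c3_def by (simp add: binomial_right_mono)
  then have "0 < c2 - N" using IN by linarith
  then have "(c2 - N) * (c2 - N) \<le> real (card P) * real (card Q)"
    using PN QN by (intro mult_mono) auto
  also have "\<dots> \<le> card (P \<inter> Q) * T" using corr unfolding T_def by (simp flip: of_nat_mult)
  also have "\<dots> \<le> (c3 - N) * T" using IN by (intro mult_right_mono) (auto simp: T_def)
  finally have 1: "(c2 - N) * (c2 - N) \<le> c3 * T - N * T" by (simp add: algebra_simps)
  have "2 * c2 * b \<le> T * b"
    unfolding T[symmetric] using assms(5) \<open>0 < c2\<close> by (simp add: algebra_simps)
  then have "2 * c2 \<le> T" using c by simp
  then have "N * (2 * c2) \<le> N * T" using \<open>0 \<le> N\<close> by (rule mult_left_mono)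
  then have 2: "c2 * c2 \<le> c3 * T" using 1 by (simp add: algebra_simps) (smt (verit) zero_le_square)
  \<comment> \<open>The ratios give the opposite strict inequality, since
    \<open>(b - 1) * (a + b) < b * (a + b - 1)\<close>.\<close>
  have "(c3 * T) * (real b * (real a + real b - 1)) = ((real a + real b - 1) * c3) * (T * b)"
    by (simp add: algebra_simps)
  also have "\<dots> = (c2 * c2) * ((real b - 1) * (real a + real b))"
    unfolding c3 T[symmetric] by (simp add: algebra_simps)
  also have "\<dots> < (c2 * c2) * (real b * (real a + real b - 1))"
    using \<open>0 < c2\<close> assms(5) by (intro mult_strict_left_mono) (auto simp: algebra_simps)
  also have "\<dots> \<le> (c3 * T) * (real b * (real a + real b - 1))"
    using 2 c by (intro mult_right_mono) auto
  finally show False by simp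
qed

text \<open>The shift moves a positive amount from the count at \<open>i\<close> to the count at
  \<open>j > i\<close> and leaves the other counts alone, so weighting by position gives an
  increasing potential.\<close>

lemma shift_weight_less:
  fixes X :: "nat set"
  assumes "finite X" "finite F" "i \<in> X" "j \<in> X" "i < j" "shift i j F \<noteq> F"
  shows "(\<Sum>l\<in>X. l * card (deletion l F)) < (\<Sum>l\<in>X. l * card (deletion l (shift i j F)))"
proof -
  let ?S = "shift i j F"
  have ne: "i \<noteq> j" using assms(5) by simp
  have split: "(\<Sum>l\<in>X. g l) = g i + (g j + (\<Sum>l\<in>X - {i} - {j}. g l))" for g :: "nat \<Rightarrow> nat"
    using assms(1,3,4) ne by (simp add: sum.remove)
  have rest: "(\<Sum>l\<in>X - {i} - {j}. l * card (deletion l ?S)) = (\<Sum>l\<in>X - {i} - {j}. l * card (deletion l F))"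
    using card_deletion_shift_other[OF assms(2) ne] by (intro sum.cong) auto
  note sum = card_deletion_shift_sum[OF assms(2) ne]
  obtain d where d: "card (deletion i F) = card (deletion i ?S) + d" "0 < d"
    using card_deletion_shift_less[OF assms(2) ne assms(6)] by (metis less_imp_add_positive)
  then have "card (deletion j ?S) = card (deletion j F) + d" using sum by simp
  then show ?thesis
    using d assms(5) rest unfolding split[of "\<lambda>l. l * card (deletion l F)"] split[of "\<lambda>l. l * card (deletion l ?S)"]
    by (simp add: algebra_simps)
qed

text \<open>Among the counterexamples choose one which is as far shifted to the left as possible. A shift
  that changes it must leave the class of counterexamples, i.e. it must collapse a diversity.\<close>

lemma exists_small_diversity:
  assumes "F \<subseteq> nsets {1..a + b + 2} (Suc b)" "intersecting F" "2 \<le> b" "b < a"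
    and "((a + b + 1) choose b) + ((a + b - 2) choose a) < card F + ((a + b - 2) choose b)"
  shows "\<exists>i\<in>{1..a + b + 2}. card (deletion i F) \<le> (a + b - 1) choose a"
proof (rule ccontr)
  assume neg: "\<not> ?thesis"
  define X where "X = {1..a + b + 2}"
  have X: "finite X" "card X = a + b + 2" "1 \<in> X" by (auto simp: X_def)
  define ce where "ce F \<longleftrightarrow> F \<subseteq> nsets X (Suc b) \<and> intersecting F \<and>
    ((a + b + 1) choose b) + ((a + b - 2) choose a) < card F + ((a + b - 2) choose b) \<and>
    (\<forall>i\<in>X. (a + b - 1) choose a < card (deletion i F))" for F
  define w where "w F = (\<Sum>l\<in>X. l * card (deletion l F))" for F
  have "ce F" using assms neg by (auto simp: ce_def X_def not_le)
  have "finite {F. ce F}"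
    by (rule finite_subset[of _ "Pow (nsets X (Suc b))"])
      (auto simp: ce_def X finite_imp_finite_nsets)
  then have fin: "finite (w ` {F. ce F})" by simp
  then have "Max (w ` {F. ce F}) \<in> w ` {F. ce F}" using \<open>ce F\<close> by (intro Max_in) auto
  then obtain G where G: "ce G" "Max (w ` {F. ce F}) = w G" by auto
  have wmax: "w H \<le> w G" if "ce H" for H
    unfolding G(2)[symmetric] using fin that by (intro Max_ge) auto
  note G' = G(1)[unfolded ce_def]
  have fG: "finite G" using G' X finite_nsets_sub by blast
  \<comment> \<open>As \<open>w G\<close> is maximal, the shifted family is no counterexample, so
    some count has become small. Only the count at \<open>i\<close> can have fallen, and if it were
    still at least \<open>(a + b - 2) choose a\<close>, the general bound would apply to the shifted
    family, which has the size of \<open>G\<close>.\<close>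
  have collapse: "card (deletion i (shift i j G)) < (a + b - 2) choose a"
    if "i \<in> X" "j \<in> X" "i < j" "shift i j G \<noteq> G" for i j
  proof -
    let ?S = "shift i j G"
    have ne: "i \<noteq> j" using that by simp
    have "w G < w ?S" unfolding w_def using shift_weight_less[OF X(1) fG that] .
    then have "\<not> ce ?S" using wmax[of ?S] by linarith
    moreover have S: "?S \<subseteq> nsets X (Suc b)" "intersecting ?S" "card ?S = card G"
      using G' shift_nsets[of G X "Suc b" i j] shift_intersecting[of G i j] card_shift[OF fG ne] that ne
      by auto
    ultimately obtain l where l: "l \<in> X" "card (deletion l ?S) \<le> (a + b - 1) choose a"
      using G' by (auto simp: ce_def not_less)
    have "card (deletion j G) \<le> card (deletion j ?S)"
      using card_deletion_shift_sum[OF fG ne] card_deletion_shift_less[OF fG ne that(4)] by linarith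
    then have "l = i"
      using l G' card_deletion_shift_other[OF fG ne, of l] that(2) by (metis leD le_trans)
    show ?thesis
    proof (rule ccontr)
      assume "\<not> ?thesis"
      then have "card ?S + ((a + b - 2) choose b) \<le> ((a + b + 1) choose b) + ((a + b - 2) choose a)"
        using l \<open>l = i\<close> S X assms(3,4) by (intro intersecting_card_bound_nat[of X a b ?S i]) auto
      then show False using S(3) G' by simp
    qed
  qed
  have fixed: "shift i j G = G" if ij: "i \<in> X" "j \<in> X" "i < j" for i j
  proof (rule ccontr)
    assume "shift i j G \<noteq> G"
    note cij = collapse[OF ij this]
    have "shift p q G = G" if pq: "p \<in> X - {i, j}" "q \<in> X - {i, j}" "p < q" for p q
    proof (rule ccontr)
      assume "shift p q G \<noteq> G"
      then have "card (deletion p (shift p q G)) < (a + b - 2) choose a" using collapse[of p q] pq by simp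
      then have "card G + ((a + b - 2) choose b) \<le> ((a + b + 1) choose b) + ((a + b - 2) choose a)"
        using cij ij pq X assms(3,4) G'
        by (intro two_disjoint_collapses[of X a b G i j p q]) auto
      then show False using G' by simp
    qed
    then have "shifted_on (X - {i, j}) G"
      by (rule shifted_onI)
    then have "(a + b - 2) choose a \<le> card (deletion i (shift i j G))"
      using ij X assms(3,4) G' by (intro no_collapse_of_shifted[of X a b G i j]) auto
    then show False using cij by simp
  qed
  then have "shifted_on X G"
    using fixed by (intro shifted_onI) blast
  then have "card (deletion 1 G) \<le> (a + b - 2) choose a"
    using G' assms(4) by (intro shifted_dichotomy) (auto simp: X_def)
  also have "\<dots> \<le> (a + b - 1) choose a" by (intro binomial_right_mono) simp
  finally show False using G' X(3) by (meson leD)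
qed

section \<open>Diversity as the smallest number of sets avoiding a point\<close>

lemma diversity_attained:
  assumes "finite F" "0 < n"
  obtains i where "i \<in> {1..n}" "diversity n F = card (deletion i F)"
    "\<And>j. j \<in> {1..n} \<Longrightarrow> diversity n F \<le> card (deletion j F)"
proof -
  define d where "d i = card {A \<in> F. i \<in> A}" for i
  \<comment> \<open>Degree and number of avoiding sets add up to \<open>card F\<close>, so a point
    of maximum degree minimises the latter.\<close>
  have d: "card F = d i + card (deletion i F)" for i
  proof -
    have "F = {A \<in> F. i \<in> A} \<union> deletion i F" "{A \<in> F. i \<in> A} \<inter> deletion i F = {}" by (auto simp: deletion_def)
    then show ?thesis using assms(1) card_Un_disjoint[of "{A \<in> F. i \<in> A}" "deletion i F"]
      by (simp add: d_def finite_deletion)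
  qed
  have M: "max_degree n F = Max (d ` {1..n})" by (simp add: max_degree_def d_def[abs_def])
  have "Max (d ` {1..n}) \<in> d ` {1..n}" using assms(2) by (intro Max_in) auto
  then obtain i where i: "i \<in> {1..n}" "max_degree n F = d i" using M by auto
  have "d j \<le> max_degree n F" if "j \<in> {1..n}" for j using that M by simp
  then have "diversity n F \<le> card (deletion j F)" if "j \<in> {1..n}" for j
    using that d[of j] unfolding diversity_def by (metis diff_add_inverse diff_le_mono2)
  moreover have "diversity n F = card (deletion i F)" using i d[of i] by (simp add: diversity_def)
  ultimately show thesis using that i(1) by blast
qed

theorem theorem2:
  fixes n k :: nat and u :: real and F :: "nat set set"
  assumes "k > 0" and "n > 2 * k"
    and "F \<subseteq> nsets {1..n} k"
    and "intersecting F"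
    and "3 \<le> u" and "u \<le> real k"
    and "real (diversity n F) \<ge> (real n - u - 1) gchoose (n - k - 1)"
  shows "real (card F) \<le> real ((n - 1) choose (k - 1))
      + ((real n - u - 1) gchoose (n - k - 1))
      - ((real n - u - 1) gchoose (k - 1))"
proof -
  define a b where "a = n - k - 1" and "b = k - 1"
  define y where "y = real n - u - 1"
  have "3 \<le> k" using assms(5,6) by linarith
  then have ab: "n = a + b + 2" "k = Suc b" "2 \<le> b" "b < a"
    using assms(2) by (simp_all add: a_def b_def)
  \<comment> \<open>The lower bound is \<open>u \<le> k\<close>, the upper one
    \<open>3 \<le> u\<close>.\<close>
  have y: "real a \<le> y" "y \<le> real (a + b) - 2" using assms(5,6) ab by (simp_all add: y_def)
  have "finite F" using assms(3) finite_nsets_sub by blast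
  then obtain i where i: "i \<in> {1..n}" "diversity n F = card (deletion i F)"
    "\<And>j. j \<in> {1..n} \<Longrightarrow> diversity n F \<le> card (deletion j F)"
    using diversity_attained[of F n] ab(1) by auto
  have F: "F \<subseteq> nsets {1..a + b + 2} (Suc b)" using assms(3) ab(1,2) by simp
  have yd: "y gchoose a \<le> card (deletion i F)" using assms(7) i(2) by (simp add: y_def a_def)
  have "card F + (y gchoose b) \<le> ((a + b + 1) choose b) + (y gchoose a)"
  proof (cases "card (deletion i F) \<le> (a + b - 1) choose a")
    case True
    then show ?thesis
      using F assms(4) i(1) ab y yd by (intro intersecting_card_bound[of "{1..n}" a b F i]) auto
  next
    case False
    \<comment> \<open>The diversity is the minimum, so all counts are large and the fixed bound at
      \<open>a + b - 2\<close> holds. As \<open>y\<close> is at most this value, the bound at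
      \<open>y\<close> is no smaller.\<close>
    then have "\<not> (\<exists>j\<in>{1..a + b + 2}. card (deletion j F) \<le> (a + b - 1) choose a)"
      using i(2,3) ab(1) by fastforce
    then have "card F + ((a + b - 2) choose b) \<le> ((a + b + 1) choose b) + ((a + b - 2) choose a)"
      using exists_small_diversity[OF F assms(4) ab(3,4)] not_less by blast
    then have "card F + real ((a + b - 2) choose b) \<le>
      ((a + b + 1) choose b) + real ((a + b - 2) choose a)" by (simp flip: of_nat_add)
    moreover define q where "q = a + b - 2"
    have "real q = real (a + b) - 2" using ab(3) by (simp add: q_def)
    then have "(real q gchoose a) - (real q gchoose b) \<le> (y gchoose a) - (y gchoose b)"
      using gbinomial_diff_le[of b a y "real q"] ab y by simp
    ultimately show ?thesis by (simp add: q_def[symmetric] flip: binomial_gbinomial)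
  qed
  moreover have "n - 1 = a + b + 1" using ab(1) by simp
  ultimately show ?thesis
    unfolding y_def[symmetric] a_def[symmetric] b_def[symmetric] by simp
qed

end
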